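(* Let $M$ be a connected Riemannian manifold (without boundary). For any $m\in\mathbb N\cup\{\infty\}$, the family $$\mathcal W^2(M)=\{P_{\Omega_x}T^2_xf^{\mathbf e}_{(j,k)}:x\in X,\ j\ge j_0,\ k\in\Gamma_j,\ \mathbf e\in E_j\}$$ is a Parseval frame in $L^2(M)$ consisting of $C^m$ functions localized on the geodesic balls $\Omega_x$, $x\in X$. That is, $$\|f\|_2^2=\sum_{x\in X}\sum_{j\ge j_0}\sum_{\mathbf e\in E_j}\sum_{k\in\Gamma_j}|\langle f,P_{\Omega_x}T^2_xf^{\mathbf e}_{(j,k)}\rangle|^2\qquad\text{for all }f\in L^2(M).$$
   Context: Notation. $A\asymp B$ means two-sided inequality up to positive constants independent of $f$; $\langle f,g\rangle=\int fg$ (the $L^2$ inner product when $g$ is real-valued; for a distribution $f$, the value $f(g)$, extended by duality). Local Parseval frame. $\mathcal W(m,j_0,\varepsilon)=\{f^{\mathbf e}_{(j,k)}\}$ is a fixed local Parseval frame of smoothness $m$, with $j_0\in\mathbb N_0$, $0<\varepsilon<1/2$, defined as follows. Let $Q=(-1,1)^d$, $Q_\varepsilon=(-1-\varepsilon,1+\varepsilon)^d$, $E'=\{0,1\}^d$, $E=E'\setminus\{0\}$, $E_{j_0}=E'$, $E_j=E$ for $j>j_0$. A local Parseval frame of smoothness $m\in\mathbb N\cup\{\infty\}$ is a family $\{f^{\mathbf e}_{(j,k)}:j\ge j_0,k\in\Gamma_j,\mathbf e\in E_j\}$ together with $\Gamma_j\subset\mathbb Z^d$ and a natural number $\lambda\ge2$,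 where $\Gamma_j\subset\Lambda_j:=\mathbb Z^d\cap[-2^{j-1}\lambda,2^{j-1}\lambda)^d$ if $m<\infty$ and $\Gamma_j=\mathbb Z^d$ if $m=\infty$, such that, with $\rho_{j,k}(x)=2^{jd/2}\chi_{[0,1]^d}(2^j\lambda x-k)$ if $m<\infty$, and $\rho_{j,k}(x)=2^{jd/2}\chi_{[0,1]^d}(2^j\lambda x-k')$ with $k'\in\Lambda_j$, $k-k'\in2^j\lambda\mathbb Z^d$, if $m=\infty$: (a) $f^{\mathbf e}_{(j,k)}\in C^m(\mathbb R^d)$, $\operatorname{supp}f^{\mathbf e}_{(j,k)}\subset Q_\varepsilon$; (b) $\|f\|_2^2=\sum_{j,\mathbf e,k}|\langle f,f^{\mathbf e}_{(j,k)}\rangle|^2$ for $f\in L^2(\mathbb R^d)$ with $\operatorname{supp}f\subset Q$; (c) for all $s\in\mathbb R$, $0<p<\infty$, $0<q\le\infty$ with $m>\max(s,\sigma_{p,q}-s)$, $\sigma_{p,q}=d\max(1/p-1,1/q-1,0)$, and all $f\in\mathbf F^s_{p,q}(\mathbb R^d)$ (Triebel-Lizorkin space) with $\operatorname{supp}f\subset Q$: $f=\sum_{j,\mathbf e,k}\langle f,f^{\mathbf e}_{(j,k)}\rangle f^{\mathbf e}_{(j,k)}$ unconditionally in $\mathbf F^s_{p,q}$ if $q<\infty$, in $\mathbf F^{s-\epsilon}_{p,q}$ for every $\epsilon>0$ if $q=\infty$; and $\|f\|_{\mathbf F^s_{p,q}}\asymp\big\|\big(\sum_{j,\mathbf e,k}(2^{js}|\langle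 f,f^{\mathbf e}_{(j,k)}\rangle|\rho_{j,k})^q\big)^{1/q}\big\|_{L^p}$. Geometry. $M$ is smooth, $d$-dimensional, with Riemannian measure $\nu$. For each $x\in M$ fix $r=r(x)>0$ such that $\exp_x$ is a well-defined diffeomorphism of $B(0,r)\subset T_xM$ onto a precompact neighborhood $\Omega_x(r)$ of $x$; $\kappa=\kappa_x=i_x\circ\exp_x^{-1}$ with $i_x:T_xM\to\mathbb R^d$ a linear isometry. Put $\Omega_x:=\Omega_x(r(x)/(3\sqrt d))$. For $f$ on $B(0,3\sqrt d)\subset\mathbb R^d$, $T^2_xf(u)=(3\sqrt d/r)^{d/2}f\big(\tfrac{3\sqrt d}{r}\kappa(u)\big)|\det g_\kappa(u)|^{-1/4}$, $u\in\Omega_x(r)$, where $\det g_\kappa$ is the determinant of the metric matrix in the chart $\kappa$; functions with support inside $\Omega_x(r)$ are extended by zero to $M$. Decomposition of identity. A simple $H$-operator on $M$ is $H_{\varphi,\Phi,V}f(x)=\varphi(x)f(\Phi(x))$ for $x\in V$, $0$ otherwise, with $\Phi:V\to V'$ a $C^\infty$ diffeomorphism of open subsets of $M$ and $\varphi:M\to\mathbb R$ compactly supported, $C^\infty$, $\operatorname{supp}\varphi\subset V$. $\mathcal H(M)$ is the set of finite combinations of these; $T\in\mathcal H(M)$ is localized on an open $U$ if it is a finite combination with all $V,\Phi(V)\subset U$. $X\subset M$ is at most countable and $\{P_{\Omega_x}\}_{x\in X}$ is a smooth (orthogonal) decomposition of identity in $L^2(M)$ subordinate to $\{\Omega_x\}_{x\in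 X}$, i.e.: it is locally finite (for any compact $K$ only finitely many nonzero $P_{\Omega_x}$ have $\Omega_x\cap K\ne\emptyset$); each $P_{\Omega_x}\in\mathcal H(M)$ is localized on $\Omega_x$ and is an orthogonal projection on $L^2(M)$; $P_{\Omega_x}P_{\Omega_y}=0$ for $x\ne y$; $\sum_{x\in X}P_{\Omega_x}=\mathbf I$ unconditionally in the strong operator topology; and $\sum_x\|P_{\Omega_x}f\|_2^2=\|f\|_2^2$. (Such $X$ and projections exist by earlier work of the authors.) *)

theory Defs
  imports "HOL-Analysis.Analysis"
begin

section \<open>Functions of class \<open>C\<^sup>m\<close> on Euclidean space\<close>

primrec iter_deriv ::
  "'e::euclidean_space list \<Rightarrow> ('e \<Rightarrow> 'b::real_normed_vector) \<Rightarrow> 'e \<Rightarrow> 'b" where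
  "iter_deriv [] f = f"
| "iter_deriv (b # bs) f = (\<lambda>x. frechet_derivative (iter_deriv bs f) (at x) b)"

text \<open>To be used for open \<open>S\<close>.  The differentiability clause ensures that every
  derivative occurring in \<^const>\<open>iter_deriv\<close> really exists.\<close>

definition Cm_on ::
  "enat \<Rightarrow> 'e::euclidean_space set \<Rightarrow> ('e \<Rightarrow> 'b::real_normed_vector) \<Rightarrow> bool" where
  "Cm_on m S f \<longleftrightarrow>
     (\<forall>bs. set bs \<subseteq> Basis \<and> enat (length bs) \<le> m \<longrightarrow> continuous_on S (iter_deriv bs f)) \<and>
     (\<forall>bs. set bs \<subseteq> Basis \<and> enat (length bs) < m \<longrightarrow>
        (\<forall>x\<in>S. iter_deriv bs f differentiable (at x)))"

definition fun_support :: "('a::topological_space \<Rightarrow> 'b::zero) \<Rightarrow> 'a set" where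
  "fun_support f = closure {x. f x \<noteq> 0}"


section \<open>Smooth manifolds\<close>

text \<open>A manifold is a topological space, here the whole type \<open>'a\<close>, with a maximal smooth
  atlas.  A chart is a pair of an open set and a coordinate map; the values of the coordinate
  map outside of that set are irrelevant.\<close>

type_synonym ('a, 'e) chart = "'a set \<times> ('a \<Rightarrow> 'e)"

definition is_chart :: "('a::topological_space, 'e::euclidean_space) chart \<Rightarrow> bool" where
  "is_chart = (\<lambda>(U, \<phi>). open U \<and> open (\<phi> ` U) \<and> homeomorphism U (\<phi> ` U) \<phi> (inv_into U \<phi>))"

definition smooth_transition ::
  "('a::topological_space, 'e::euclidean_space) chart \<Rightarrow> ('a, 'e) chart \<Rightarrow> bool" where
  "smooth_transition = (\<lambda>(U, \<phi>) (V, \<psi>). Cm_on \<infinity> (\<phi> ` (U \<inter> V)) (\<psi> \<circ> inv_into U \<phi>))"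

definition smooth_structure ::
  "('a::topological_space, 'e::euclidean_space) chart set \<Rightarrow> bool" where
  "smooth_structure A \<longleftrightarrow>
     (\<forall>c\<in>A. is_chart c) \<and> (\<Union>c\<in>A. fst c) = UNIV \<and>
     (\<forall>c\<in>A. \<forall>c'\<in>A. smooth_transition c c') \<and>
     (\<forall>c. is_chart c \<and> (\<forall>c'\<in>A. smooth_transition c c' \<and> smooth_transition c' c) \<longrightarrow> c \<in> A)"

definition eucl_structure :: "('e, 'e::euclidean_space) chart set" where
  "eucl_structure =
     {c. is_chart c \<and> smooth_transition c (UNIV, id) \<and> smooth_transition (UNIV, id) c}"

definition smooth_map ::
  "('a::topological_space, 'e::euclidean_space) chart set \<Rightarrow>
   ('b::topological_space, 'f::euclidean_space) chart set \<Rightarrow> 'a set \<Rightarrow> ('a \<Rightarrow> 'b) \<Rightarrow> bool" where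
  "smooth_map A B W f \<longleftrightarrow> continuous_on W f \<and>
     (\<forall>(U, \<phi>)\<in>A. \<forall>(V, \<psi>)\<in>B.
        Cm_on \<infinity> (\<phi> ` (U \<inter> W \<inter> f -` V)) (\<psi> \<circ> f \<circ> inv_into U \<phi>))"

definition diffeomorphism ::
  "('a::topological_space, 'e::euclidean_space) chart set \<Rightarrow>
   ('b::topological_space, 'f::euclidean_space) chart set \<Rightarrow>
   'a set \<Rightarrow> 'b set \<Rightarrow> ('a \<Rightarrow> 'b) \<Rightarrow> bool" where
  "diffeomorphism A B V W f \<longleftrightarrow> open V \<and> open W \<and> bij_betw f V W \<and>
     smooth_map A B V f \<and> smooth_map B A W (inv_into V f)"

definition Cm_fun ::
  "('a::topological_space, 'e::euclidean_space) chart set \<Rightarrow> enat \<Rightarrow>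
   ('a \<Rightarrow> 'b::real_normed_vector) \<Rightarrow> bool" where
  "Cm_fun A m f \<longleftrightarrow> (\<forall>(U, \<phi>)\<in>A. Cm_on m (\<phi> ` U) (f \<circ> inv_into U \<phi>))"


section \<open>Tangent vectors, Riemannian metrics, geodesics\<close>

text \<open>Tangent vectors at \<open>x\<close> are the derivations at \<open>x\<close> of the algebra of smooth real
  functions on the manifold, extended by \<open>0\<close> to functions that are not smooth.\<close>

type_synonym 'a tvec = "('a \<Rightarrow> real) \<Rightarrow> real"

definition tangent_space ::
  "('a::topological_space, 'e::euclidean_space) chart set \<Rightarrow> 'a \<Rightarrow> 'a tvec set" where
  "tangent_space A x = {v.
     (\<forall>f h a b. Cm_fun A \<infinity> f \<and> Cm_fun A \<infinity> h \<longrightarrow>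
        v (\<lambda>u. a * f u + b * h u) = a * v f + b * v h) \<and>
     (\<forall>f h. Cm_fun A \<infinity> f \<and> Cm_fun A \<infinity> h \<longrightarrow>
        v (\<lambda>u. f u * h u) = f x * v h + h x * v f) \<and>
     (\<forall>f. \<not> Cm_fun A \<infinity> f \<longrightarrow> v f = 0)}"

abbreviation lincomb :: "real \<Rightarrow> 'a tvec \<Rightarrow> real \<Rightarrow> 'a tvec \<Rightarrow> 'a tvec" where
  "lincomb a v b w \<equiv> (\<lambda>f. a * v f + b * w f)"

text \<open>\<open>(\<partial>h / \<partial>\<phi>\<^sub>i)(u)\<close> for a function \<open>h\<close> on the manifold and a chart \<open>(U, \<phi>)\<close>.\<close>

definition chart_partial ::
  "('a, real^'d) chart \<Rightarrow> 'd \<Rightarrow> ('a \<Rightarrow> real) \<Rightarrow> 'a \<Rightarrow> real" where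
  "chart_partial = (\<lambda>(U, \<phi>) i h u.
     frechet_derivative (h \<circ> inv_into U \<phi>) (at (\<phi> u)) (axis i 1))"

definition coord_vec ::
  "('a::topological_space, real^'d) chart set \<Rightarrow> ('a, real^'d) chart \<Rightarrow> 'a \<Rightarrow> 'd \<Rightarrow> 'a tvec" where
  "coord_vec A c u i = (\<lambda>f. if Cm_fun A \<infinity> f then chart_partial c i f u else 0)"

type_synonym 'a metric = "'a \<Rightarrow> 'a tvec \<Rightarrow> 'a tvec \<Rightarrow> real"

definition metric_matrix ::
  "('a::topological_space, real^'d) chart set \<Rightarrow> 'a metric \<Rightarrow> ('a, real^'d) chart \<Rightarrow>
   'a \<Rightarrow> real^'d^'d" where
  "metric_matrix A g c u = (\<chi> i j. g u (coord_vec A c u i) (coord_vec A c u j))"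

definition riemannian_manifold ::
  "('a::topological_space, real^'d) chart set \<Rightarrow> 'a metric \<Rightarrow> bool" where
  "riemannian_manifold A g \<longleftrightarrow> smooth_structure A \<and>
     (\<forall>x. \<forall>v\<in>tangent_space A x. \<forall>w\<in>tangent_space A x. \<forall>z\<in>tangent_space A x. \<forall>a b.
        g x v w = g x w v \<and>
        g x (lincomb a v b w) z = a * g x v z + b * g x w z \<and>
        (v \<noteq> (\<lambda>_. 0) \<longrightarrow> g x v v > 0)) \<and>
     (\<forall>(U, \<phi>)\<in>A. \<forall>i j.
        Cm_on \<infinity> (\<phi> ` U) (\<lambda>y. metric_matrix A g (U, \<phi>) (inv_into U \<phi> y) $ i $ j))"

text \<open>The Riemannian measure, characterized by \<open>d\<nu> = |det g\<^sub>\<phi>|\<^sup>1\<^sup>/\<^sup>2 dy\<close> in every chart.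
  On a second countable manifold there is exactly one such Borel measure.\<close>

definition riemannian_measure ::
  "('a::topological_space, real^'d) chart set \<Rightarrow> 'a metric \<Rightarrow> 'a measure \<Rightarrow> bool" where
  "riemannian_measure A g \<nu> \<longleftrightarrow> sets \<nu> = sets borel \<and>
     (\<forall>(U, \<phi>)\<in>A. \<forall>B\<in>sets borel. B \<subseteq> U \<longrightarrow>
        emeasure \<nu> B = (\<integral>\<^sup>+ y\<in>\<phi> ` B.
          ennreal (sqrt \<bar>det (metric_matrix A g (U, \<phi>) (inv_into U \<phi> y))\<bar>) \<partial>lborel))"

definition christoffel ::
  "('a::topological_space, real^'d) chart set \<Rightarrow> 'a metric \<Rightarrow> ('a, real^'d) chart \<Rightarrow>
   'a \<Rightarrow> 'd \<Rightarrow> 'd \<Rightarrow> 'd \<Rightarrow> real" where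
  "christoffel A g c u k i j =
     (\<Sum>l\<in>UNIV. matrix_inv (metric_matrix A g c u) $ k $ l *
        (chart_partial c i (\<lambda>x. metric_matrix A g c x $ j $ l) u +
         chart_partial c j (\<lambda>x. metric_matrix A g c x $ i $ l) u -
         chart_partial c l (\<lambda>x. metric_matrix A g c x $ i $ j) u)) / 2"

definition geodesic_on ::
  "('a::topological_space, real^'d) chart set \<Rightarrow> 'a metric \<Rightarrow> real set \<Rightarrow> (real \<Rightarrow> 'a) \<Rightarrow> bool"
where
  "geodesic_on A g I \<gamma> \<longleftrightarrow> smooth_map eucl_structure A I \<gamma> \<and>
     (\<forall>(U, \<phi>)\<in>A. \<forall>t\<in>I. \<gamma> t \<in> U \<longrightarrow>
        (\<forall>k. deriv (deriv (\<lambda>s. \<phi> (\<gamma> s) $ k)) t +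
             (\<Sum>i\<in>UNIV. \<Sum>j\<in>UNIV. christoffel A g (U, \<phi>) (\<gamma> t) k i j *
                deriv (\<lambda>s. \<phi> (\<gamma> s) $ i) t * deriv (\<lambda>s. \<phi> (\<gamma> s) $ j) t) = 0))"

definition velocity ::
  "('a::topological_space, real^'d) chart set \<Rightarrow> (real \<Rightarrow> 'a) \<Rightarrow> real \<Rightarrow> 'a tvec" where
  "velocity A \<gamma> t = (\<lambda>f. if Cm_fun A \<infinity> f then deriv (f \<circ> \<gamma>) t else 0)"

text \<open>\<open>exp_rel A g x v y\<close>: the geodesic starting at \<open>x\<close> with velocity \<open>v\<close> exists up to
  (and slightly beyond) time 1, when it is at \<open>y\<close>.\<close>

definition exp_rel ::
  "('a::topological_space, real^'d) chart set \<Rightarrow> 'a metric \<Rightarrow> 'a \<Rightarrow> 'a tvec \<Rightarrow> 'a \<Rightarrow> bool" where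
  "exp_rel A g x v y \<longleftrightarrow> (\<exists>\<gamma> \<delta>. \<delta> > 0 \<and> geodesic_on A g {-\<delta><..<1+\<delta>} \<gamma> \<and>
     \<gamma> 0 = x \<and> velocity A \<gamma> 0 = v \<and> \<gamma> 1 = y)"

definition exp_map ::
  "('a::topological_space, real^'d) chart set \<Rightarrow> 'a metric \<Rightarrow> 'a \<Rightarrow> 'a tvec \<Rightarrow> 'a" where
  "exp_map A g x v = (THE y. exp_rel A g x v y)"

definition tangent_ball ::
  "('a::topological_space, real^'d) chart set \<Rightarrow> 'a metric \<Rightarrow> 'a \<Rightarrow> real \<Rightarrow> 'a tvec set" where
  "tangent_ball A g x \<rho> = {v \<in> tangent_space A x. sqrt (g x v v) < \<rho>}"

definition geodesic_ball ::
  "('a::topological_space, real^'d) chart set \<Rightarrow> 'a metric \<Rightarrow> 'a \<Rightarrow> real \<Rightarrow> 'a set" where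
  "geodesic_ball A g x \<rho> = exp_map A g x ` tangent_ball A g x \<rho>"

definition tangent_isometry ::
  "('a::topological_space, real^'d) chart set \<Rightarrow> 'a metric \<Rightarrow> 'a \<Rightarrow> ('a tvec \<Rightarrow> real^'d) \<Rightarrow> bool"
where
  "tangent_isometry A g x \<iota> \<longleftrightarrow> bij_betw \<iota> (tangent_space A x) UNIV \<and>
     (\<forall>v\<in>tangent_space A x. \<forall>w\<in>tangent_space A x.
        (\<forall>a b. \<iota> (lincomb a v b w) = a *\<^sub>R \<iota> v + b *\<^sub>R \<iota> w) \<and> g x v w = \<iota> v \<bullet> \<iota> w)"

text \<open>Choice of radii \<open>r(x)\<close> and isometries \<open>i\<^sub>x : T\<^sub>x M \<rightarrow> \<real>\<^sup>d\<close>.  The vector space \<open>T\<^sub>x M\<close>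
  carries the smooth structure making its linear isomorphisms with \<open>\<real>\<^sup>d\<close> diffeomorphisms;
  smoothness of \<open>exp\<^sub>x\<close> is hence that of \<open>exp\<^sub>x \<circ> i\<^sub>x\<^sup>-\<^sup>1\<close>.\<close>

definition normal_radii ::
  "('a::topological_space, real^'d) chart set \<Rightarrow> 'a metric \<Rightarrow> ('a \<Rightarrow> real) \<Rightarrow>
   ('a \<Rightarrow> 'a tvec \<Rightarrow> real^'d) \<Rightarrow> bool" where
  "normal_radii A g r \<iota> \<longleftrightarrow> (\<forall>x. r x > 0 \<and> tangent_isometry A g x (\<iota> x) \<and>
     (\<forall>v\<in>tangent_ball A g x (r x). \<exists>!y. exp_rel A g x v y) \<and>
     diffeomorphism eucl_structure A (ball 0 (r x)) (geodesic_ball A g x (r x))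
       (exp_map A g x \<circ> inv_into (tangent_space A x) (\<iota> x)) \<and>
     x \<in> geodesic_ball A g x (r x) \<and> compact (closure (geodesic_ball A g x (r x))))"

definition normal_coord ::
  "('a::topological_space, real^'d) chart set \<Rightarrow> 'a metric \<Rightarrow> ('a \<Rightarrow> real) \<Rightarrow>
   ('a \<Rightarrow> 'a tvec \<Rightarrow> real^'d) \<Rightarrow> 'a \<Rightarrow> 'a \<Rightarrow> real^'d" where
  "normal_coord A g r \<iota> x = \<iota> x \<circ> inv_into (tangent_ball A g x (r x)) (exp_map A g x)"

text \<open>\<open>\<Omega>\<^sub>x = \<Omega>\<^sub>x(r(x) / (3 \<surd>d))\<close>.\<close>

definition Omega ::
  "('a::topological_space, real^'d) chart set \<Rightarrow> 'a metric \<Rightarrow> ('a \<Rightarrow> real) \<Rightarrow> 'a \<Rightarrow> 'a set" where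
  "Omega A g r x = geodesic_ball A g x (r x / (3 * sqrt (real CARD('d))))"

text \<open>The localization operators \<open>T\<^sup>2\<^sub>x\<close>, including the extension by zero.\<close>

definition T2 ::
  "('a::topological_space, real^'d) chart set \<Rightarrow> 'a metric \<Rightarrow> ('a \<Rightarrow> real) \<Rightarrow>
   ('a \<Rightarrow> 'a tvec \<Rightarrow> real^'d) \<Rightarrow> 'a \<Rightarrow> (real^'d \<Rightarrow> complex) \<Rightarrow> 'a \<Rightarrow> complex" where
  "T2 A g r \<iota> x f u =
     (let \<Omega> = geodesic_ball A g x (r x); \<kappa> = normal_coord A g r \<iota> x;
          s = 3 * sqrt (real CARD('d)) / r x
      in if u \<in> \<Omega>
         then of_real (s powr (real CARD('d) / 2)) * f (s *\<^sub>R \<kappa> u) *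
              of_real (\<bar>det (metric_matrix A g (\<Omega>, \<kappa>) u)\<bar> powr (- 1 / 4))
         else 0)"


section \<open>\<open>L\<^sup>2\<close> spaces and Parseval frames\<close>

definition L2_fun :: "'a measure \<Rightarrow> ('a \<Rightarrow> complex) \<Rightarrow> bool" where
  "L2_fun M f \<longleftrightarrow> f \<in> borel_measurable M \<and> integrable M (\<lambda>x. (cmod (f x))\<^sup>2)"

definition L2_nrm :: "'a measure \<Rightarrow> ('a \<Rightarrow> complex) \<Rightarrow> real" where
  "L2_nrm M f = sqrt (\<integral>x. (cmod (f x))\<^sup>2 \<partial>M)"

text \<open>The pairing \<open>\<langle>f, g\<rangle> = \<integral> f g\<close> is bilinear; it is the inner product if \<open>g\<close> is real-valued.\<close>

definition pairing :: "'a measure \<Rightarrow> ('a \<Rightarrow> complex) \<Rightarrow> ('a \<Rightarrow> complex) \<Rightarrow> complex" where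
  "pairing M f g = (\<integral>x. f x * g x \<partial>M)"

definition parseval_frame :: "'a measure \<Rightarrow> 'i set \<Rightarrow> ('i \<Rightarrow> 'a \<Rightarrow> complex) \<Rightarrow> bool" where
  "parseval_frame M I h \<longleftrightarrow> (\<forall>i\<in>I. L2_fun M (h i)) \<and>
     (\<forall>f. L2_fun M f \<longrightarrow> ((\<lambda>i. (cmod (pairing M f (h i)))\<^sup>2) has_sum (L2_nrm M f)\<^sup>2) I)"


section \<open>Tempered distributions and Triebel-Lizorkin spaces\<close>

definition schwartz :: "('e::euclidean_space \<Rightarrow> complex) set" where
  "schwartz = {\<psi>. Cm_on \<infinity> UNIV \<psi> \<and>
     (\<forall>N bs. set bs \<subseteq> Basis \<longrightarrow> bounded (range (\<lambda>x. (1 + norm x) ^ N *\<^sub>R iter_deriv bs \<psi> x)))}"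

definition schwartz_seminorm :: "nat \<Rightarrow> ('e::euclidean_space \<Rightarrow> complex) \<Rightarrow> real" where
  "schwartz_seminorm N \<psi> =
     (SUP (bs, x) \<in> {bs. set bs \<subseteq> Basis \<and> length bs \<le> N} \<times> UNIV.
        (1 + norm x) ^ N * cmod (iter_deriv bs \<psi> x))"

text \<open>Distributions are functionals of which only the values on Schwartz functions matter.\<close>

type_synonym 'e distrib = "('e \<Rightarrow> complex) \<Rightarrow> complex"

definition tempered :: "'e::euclidean_space distrib \<Rightarrow> bool" where
  "tempered f \<longleftrightarrow>
     (\<forall>\<psi>\<in>schwartz. \<forall>\<eta>\<in>schwartz. \<forall>a b. f (\<lambda>x. a * \<psi> x + b * \<eta> x) = a * f \<psi> + b * f \<eta>) \<and>
     (\<exists>N C. \<forall>\<psi>\<in>schwartz. cmod (f \<psi>) \<le> C * schwartz_seminorm N \<psi>)"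

definition distrib_of :: "('e::euclidean_space \<Rightarrow> complex) \<Rightarrow> 'e distrib" where
  "distrib_of h = (\<lambda>\<psi>. pairing lborel h \<psi>)"

definition test_fun :: "('e::euclidean_space \<Rightarrow> complex) \<Rightarrow> bool" where
  "test_fun \<psi> \<longleftrightarrow> Cm_on \<infinity> UNIV \<psi> \<and> compact (fun_support \<psi>)"

definition distrib_support :: "'e::euclidean_space distrib \<Rightarrow> 'e set" where
  "distrib_support f =
     - \<Union>{U. open U \<and> (\<forall>\<psi>. test_fun \<psi> \<and> fun_support \<psi> \<subseteq> U \<longrightarrow> f \<psi> = 0)}"

definition ess_support :: "('e::euclidean_space \<Rightarrow> complex) \<Rightarrow> 'e set" where
  "ess_support f = - \<Union>{U. open U \<and> (AE x in lborel. x \<in> U \<longrightarrow> f x = 0)}"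

text \<open>The value \<open>\<langle>f, h\<rangle>\<close> of a distribution \<open>f\<close> at a compactly supported \<open>h\<close> of class \<open>C\<^sup>m\<close>:
  the limit of \<open>f(\<psi>\<^sub>n)\<close> for all test functions \<open>\<psi>\<^sub>n\<close>, supported in a common compact set,
  which converge to \<open>h\<close> in \<open>C\<^sup>m\<close>.  It exists for \<open>f\<close> in \<open>F\<^sup>s\<^sub>p\<^sub>,\<^sub>q\<close> if \<open>m > \<sigma>\<^sub>p\<^sub>,\<^sub>q - s\<close>,
  because \<open>f\<close> is then locally of order at most \<open>m\<close>.\<close>

definition Cm_approx ::
  "enat \<Rightarrow> (nat \<Rightarrow> 'e::euclidean_space \<Rightarrow> complex) \<Rightarrow> ('e \<Rightarrow> complex) \<Rightarrow> bool" where
  "Cm_approx m \<psi> h \<longleftrightarrow> (\<forall>n. test_fun (\<psi> n)) \<and>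
     (\<exists>K. compact K \<and> (\<forall>n. fun_support (\<psi> n) \<subseteq> K)) \<and>
     (\<forall>bs. set bs \<subseteq> Basis \<and> enat (length bs) \<le> m \<longrightarrow>
        uniform_limit UNIV (\<lambda>n. iter_deriv bs (\<psi> n)) (iter_deriv bs h) sequentially)"

definition distrib_pairing ::
  "enat \<Rightarrow> 'e::euclidean_space distrib \<Rightarrow> ('e \<Rightarrow> complex) \<Rightarrow> complex" where
  "distrib_pairing m f h = (THE c. \<forall>\<psi>. Cm_approx m \<psi> h \<longrightarrow> (\<lambda>n. f (\<psi> n)) \<longlonglongrightarrow> c)"

text \<open>Powers, \<open>\<ell>\<^sup>q\<close> and \<open>L\<^sup>p\<close> quasi-norms with values in \<open>[0, \<infinity>]\<close>, for exponents \<open>a > 0\<close>,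
  \<open>0 < q \<le> \<infinity>\<close> and \<open>0 < p < \<infinity>\<close>.\<close>

definition enn_powr :: "ennreal \<Rightarrow> real \<Rightarrow> ennreal" where
  "enn_powr x a = (if x = top then top else ennreal (enn2real x powr a))"

definition lq_norm :: "ennreal \<Rightarrow> 'i set \<Rightarrow> ('i \<Rightarrow> ennreal) \<Rightarrow> ennreal" where
  "lq_norm q I a = (if q = top then (SUP i\<in>I. a i)
     else enn_powr (\<Sum>\<^sub>\<infinity>i\<in>I. enn_powr (a i) (enn2real q)) (1 / enn2real q))"

definition Lp_norm :: "real \<Rightarrow> ('e::euclidean_space \<Rightarrow> ennreal) \<Rightarrow> ennreal" where
  "Lp_norm p h = enn_powr (\<integral>\<^sup>+ x. enn_powr (h x) p \<partial>lborel) (1 / p)"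

text \<open>A smooth dyadic resolution of unity: \<open>lp_cutoff\<close> is smooth, equal to 1 for \<open>|\<xi>| \<le> 1\<close> and
  to 0 for \<open>|\<xi>| \<ge> 2\<close>.  Any other such choice leads to the same spaces with equivalent
  quasi-norms.\<close>

definition exp_bump :: "real \<Rightarrow> real" where
  "exp_bump t = (if t > 0 then exp (- 1 / t) else 0)"

definition lp_cutoff :: "'e::euclidean_space \<Rightarrow> real" where
  "lp_cutoff \<xi> = exp_bump (2 - norm \<xi>) / (exp_bump (2 - norm \<xi>) + exp_bump (norm \<xi> - 1))"

definition lp_symbol :: "nat \<Rightarrow> 'e::euclidean_space \<Rightarrow> real" where
  "lp_symbol j \<xi> = (if j = 0 then lp_cutoff \<xi>
     else lp_cutoff ((1 / 2 ^ j) *\<^sub>R \<xi>) - lp_cutoff ((1 / 2 ^ (j - 1)) *\<^sub>R \<xi>))"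

text \<open>The inverse Fourier transform of \<^const>\<open>lp_symbol\<close>, and the Littlewood-Paley block, i.e.
  the convolution of \<open>f\<close> with it.\<close>

definition lp_kernel :: "nat \<Rightarrow> 'e::euclidean_space \<Rightarrow> complex" where
  "lp_kernel j x = (\<integral>\<xi>. cis (x \<bullet> \<xi>) * of_real (lp_symbol j \<xi>) \<partial>lborel) /
     of_real ((2 * pi) ^ DIM('e))"

definition lp_block :: "nat \<Rightarrow> 'e::euclidean_space distrib \<Rightarrow> 'e \<Rightarrow> complex" where
  "lp_block j f x = f (\<lambda>y. lp_kernel j (x - y))"

definition TL_norm :: "real \<Rightarrow> real \<Rightarrow> ennreal \<Rightarrow> 'e::euclidean_space distrib \<Rightarrow> ennreal" where
  "TL_norm s p q f = Lp_norm p (\<lambda>x. lq_norm q UNIV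
     (\<lambda>j::nat. ennreal (2 powr (real j * s) * cmod (lp_block j f x))))"

definition TL_space :: "real \<Rightarrow> real \<Rightarrow> ennreal \<Rightarrow> 'e::euclidean_space distrib set" where
  "TL_space s p q = {f. tempered f \<and> TL_norm s p q f < top}"

text \<open>Unconditional convergence of a series to \<open>f\<close> in \<open>F\<^sup>s\<^sub>p\<^sub>,\<^sub>q\<close>, as convergence of the net of
  finite partial sums.\<close>

definition TL_unconditional ::
  "real \<Rightarrow> real \<Rightarrow> ennreal \<Rightarrow> 'i set \<Rightarrow> ('i \<Rightarrow> 'e::euclidean_space distrib) \<Rightarrow> 'e distrib \<Rightarrow> bool"
where
  "TL_unconditional s p q I a f \<longleftrightarrow>
     (\<forall>i\<in>I. a i \<in> TL_space s p q) \<and>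
     ((\<lambda>F. TL_norm s p q (\<lambda>\<psi>. f \<psi> - (\<Sum>i\<in>F. a i \<psi>))) \<longlongrightarrow> 0) (finite_subsets_at_top I)"


section \<open>Local Parseval frames\<close>

definition open_cube :: "real \<Rightarrow> (real^'d) set" where
  "open_cube a = {x. \<forall>i. - a < x $ i \<and> x $ i < a}"

definition E_set :: "nat \<Rightarrow> nat \<Rightarrow> (int^'d) set" where
  "E_set j0 j = (if j = j0 then {e. \<forall>i. e $ i \<in> {0, 1}} else {e. \<forall>i. e $ i \<in> {0, 1}} - {0})"

definition Lambda_set :: "nat \<Rightarrow> nat \<Rightarrow> (int^'d) set" where
  "Lambda_set lam j = {k. \<forall>i. - (2 ^ j * real lam / 2) \<le> real_of_int (k $ i) \<and>
     real_of_int (k $ i) < 2 ^ j * real lam / 2}"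

text \<open>\<open>\<rho>\<^sub>j\<^sub>,\<^sub>k\<close>; for \<open>m = \<infinity>\<close> the index \<open>k\<close> is replaced by its unique representative in
  \<open>\<Lambda>\<^sub>j\<close> modulo \<open>2\<^sup>j \<lambda> \<int>\<^sup>d\<close>.\<close>

definition rho :: "enat \<Rightarrow> nat \<Rightarrow> nat \<Rightarrow> int^'d \<Rightarrow> real^'d \<Rightarrow> real" where
  "rho m lam j k x =
     (let k' = (if m = \<infinity>
                then (THE k'. k' \<in> Lambda_set lam j \<and> (\<forall>i. 2 ^ j * int lam dvd k $ i - k' $ i))
                else k)
      in 2 powr (real j * real CARD('d) / 2) *
         indicator {y. \<forall>i. 0 \<le> y $ i \<and> y $ i \<le> 1}
           (\<chi> i. 2 ^ j * real lam * x $ i - real_of_int (k' $ i)))"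

definition recip :: "ennreal \<Rightarrow> real" where
  "recip q = (if q = top then 0 else 1 / enn2real q)"

definition sigma_pq :: "nat \<Rightarrow> real \<Rightarrow> ennreal \<Rightarrow> real" where
  "sigma_pq d p q = real d * Max {1 / p - 1, recip q - 1, 0}"

definition frame_index :: "nat \<Rightarrow> (nat \<Rightarrow> (int^'d) set) \<Rightarrow> (nat \<times> (int^'d) \<times> (int^'d)) set" where
  "frame_index j0 \<Gamma> = {(j, e, k). j0 \<le> j \<and> e \<in> E_set j0 j \<and> k \<in> \<Gamma> j}"

text \<open>\<open>w (j, e, k)\<close> is the frame element \<open>f\<^sup>e\<^sub>(\<^sub>j\<^sub>,\<^sub>k\<^sub>)\<close>.\<close>

definition local_parseval_frame ::
  "enat \<Rightarrow> nat \<Rightarrow> real \<Rightarrow> nat \<Rightarrow> (nat \<Rightarrow> (int^'d) set) \<Rightarrow>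
   (nat \<times> (int^'d) \<times> (int^'d) \<Rightarrow> real^'d \<Rightarrow> complex) \<Rightarrow> bool" where
  "local_parseval_frame m j0 \<epsilon> lam \<Gamma> w \<longleftrightarrow>
     m \<ge> 1 \<and> 0 < \<epsilon> \<and> \<epsilon> < 1/2 \<and> lam \<ge> 2 \<and>
     (\<forall>j\<ge>j0. if m = \<infinity> then \<Gamma> j = UNIV else \<Gamma> j \<subseteq> Lambda_set lam j) \<and>
     (\<forall>i\<in>frame_index j0 \<Gamma>.
        Cm_on m UNIV (w i) \<and> fun_support (w i) \<subseteq> open_cube (1 + \<epsilon>)) \<and>
     (\<forall>f. L2_fun lborel f \<and> ess_support f \<subseteq> open_cube 1 \<longrightarrow>
        ((\<lambda>i. (cmod (pairing lborel f (w i)))\<^sup>2) has_sum (L2_nrm lborel f)\<^sup>2)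
          (frame_index j0 \<Gamma>)) \<and>
     (\<forall>s p q. 0 < p \<and> 0 < q \<and>
        ereal (max s (sigma_pq CARD('d) p q - s)) < ereal_of_enat m \<longrightarrow>
        (\<forall>f\<in>TL_space s p q. distrib_support f \<subseteq> open_cube 1 \<longrightarrow>
           (let a = (\<lambda>i \<psi>. distrib_pairing m f (w i) * distrib_of (w i) \<psi>)
            in if q < top then TL_unconditional s p q (frame_index j0 \<Gamma>) a f
               else \<forall>\<delta>>0. TL_unconditional (s - \<delta>) p q (frame_index j0 \<Gamma>) a f)) \<and>
        (\<exists>C1 C2. 0 < C1 \<and> 0 < C2 \<and>
           (\<forall>f\<in>TL_space s p q. distrib_support f \<subseteq> open_cube 1 \<longrightarrow>
              (let N = Lp_norm p (\<lambda>x. lq_norm q (frame_index j0 \<Gamma>)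
                     (\<lambda>(j, e, k). ennreal (2 powr (real j * s) *
                        cmod (distrib_pairing m f (w (j, e, k))) * rho m lam j k x)))
               in ennreal C1 * N \<le> TL_norm s p q f \<and> TL_norm s p q f \<le> ennreal C2 * N))))"


section \<open>Smooth decompositions of identity\<close>

definition simple_H_op ::
  "('a \<Rightarrow> real) \<Rightarrow> ('a \<Rightarrow> 'a) \<Rightarrow> 'a set \<Rightarrow> ('a \<Rightarrow> complex) \<Rightarrow> 'a \<Rightarrow> complex" where
  "simple_H_op \<phi> \<Phi> V f x = (if x \<in> V then of_real (\<phi> x) * f (\<Phi> x) else 0)"

definition simple_H_data ::
  "('a::topological_space, real^'d) chart set \<Rightarrow> ('a \<Rightarrow> real) \<Rightarrow> ('a \<Rightarrow> 'a) \<Rightarrow> 'a set \<Rightarrow> bool"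
where
  "simple_H_data A \<phi> \<Phi> V \<longleftrightarrow>
     (\<exists>V'. diffeomorphism A A V V' \<Phi>) \<and> Cm_fun A \<infinity> \<phi> \<and>
     compact (fun_support \<phi>) \<and> fun_support \<phi> \<subseteq> V"

definition H_localized ::
  "('a::topological_space, real^'d) chart set \<Rightarrow> 'a set \<Rightarrow>
   (('a \<Rightarrow> complex) \<Rightarrow> 'a \<Rightarrow> complex) \<Rightarrow> bool" where
  "H_localized A U T \<longleftrightarrow>
     (\<exists>(n::nat) c \<phi> \<Phi> V.
        (\<forall>i<n. simple_H_data A (\<phi> i) (\<Phi> i) (V i) \<and> V i \<subseteq> U \<and> \<Phi> i ` V i \<subseteq> U) \<and>
        (\<forall>f x. T f x = (\<Sum>i<n. c i * simple_H_op (\<phi> i) (\<Phi> i) (V i) f x)))"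

text \<open>Linearity is not part of the following definition, since it is only applied to operators
  satisfying \<^const>\<open>H_localized\<close>.\<close>

definition L2_projection :: "'a measure \<Rightarrow> (('a \<Rightarrow> complex) \<Rightarrow> 'a \<Rightarrow> complex) \<Rightarrow> bool" where
  "L2_projection M P \<longleftrightarrow>
     (\<forall>f. L2_fun M f \<longrightarrow> L2_fun M (P f) \<and> (AE x in M. P (P f) x = P f x)) \<and>
     (\<forall>f h. L2_fun M f \<and> L2_fun M h \<longrightarrow>
        (\<integral>x. P f x * cnj (h x) \<partial>M) = (\<integral>x. f x * cnj (P h x) \<partial>M))"

definition smooth_decomposition ::
  "('a::topological_space, real^'d) chart set \<Rightarrow> 'a measure \<Rightarrow> 'a set \<Rightarrow> ('a \<Rightarrow> 'a set) \<Rightarrow>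
   ('a \<Rightarrow> ('a \<Rightarrow> complex) \<Rightarrow> 'a \<Rightarrow> complex) \<Rightarrow> bool" where
  "smooth_decomposition A \<nu> X \<Omega> P \<longleftrightarrow>
     (\<forall>K. compact K \<longrightarrow>
        finite {x\<in>X. (\<exists>f. L2_fun \<nu> f \<and> \<not> (AE u in \<nu>. P x f u = 0)) \<and> \<Omega> x \<inter> K \<noteq> {}}) \<and>
     (\<forall>x\<in>X. H_localized A (\<Omega> x) (P x) \<and> L2_projection \<nu> (P x)) \<and>
     (\<forall>x\<in>X. \<forall>y\<in>X. x \<noteq> y \<longrightarrow> (\<forall>f. L2_fun \<nu> f \<longrightarrow> (AE u in \<nu>. P x (P y f) u = 0))) \<and>
     (\<forall>f. L2_fun \<nu> f \<longrightarrow>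
        ((\<lambda>F. L2_nrm \<nu> (\<lambda>u. f u - (\<Sum>x\<in>F. P x f u))) \<longlongrightarrow> 0) (finite_subsets_at_top X)) \<and>
     (\<forall>f. L2_fun \<nu> f \<longrightarrow> ((\<lambda>x. (L2_nrm \<nu> (P x f))\<^sup>2) has_sum (L2_nrm \<nu> f)\<^sup>2) X)"

end

theory Submission
  imports Defs
begin

text \<open>The family is a Parseval frame because the Parseval frame of the cube is transported to each
  \<open>\<Omega>\<^sub>x\<close> by an isometry, and the projections \<open>P\<^sub>x\<close> cut an \<open>L\<^sup>2\<close> function into pieces supported
  in these sets.

  In the rescaled normal coordinates \<open>z = (3 \<surd>d / r(x)) \<kappa>(u)\<close> the Riemannian measure has a density
  \<open>\<theta>\<close>, and \<open>T\<^sup>2\<^sub>x h\<close> is the function \<open>h(z) / \<surd>\<theta>(z)\<close> (lemma \<open>T2_eq_push_fun\<close>).  The transpose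
  of \<open>T\<^sup>2\<^sub>x\<close> multiplies by \<open>\<surd>\<theta>\<close> and preserves the \<open>L\<^sup>2\<close> norms of functions vanishing outside
  \<open>\<Omega>\<^sub>x(r(x))\<close>.  It maps a function vanishing outside a compact subset of \<open>\<Omega>\<^sub>x\<close> to one whose
  support is compact in the unit ball, hence in the cube \<open>Q\<close>, where the Parseval identity of the local frame applies.  The range of \<open>P\<^sub>x\<close> consists of such
  functions, since an operator localized on \<open>\<Omega>\<^sub>x\<close> is a finite sum of operators whose cutoffs have
  compact support in \<open>\<Omega>\<^sub>x\<close>.  As \<open>\<langle>f, P\<^sub>x T\<^sup>2\<^sub>x h\<rangle>\<close> is the pairing of \<open>T\<^sup>2\<^sub>x h\<close> with
  \<open>cnj (P\<^sub>x (cnj f))\<close>, the sum over the frame elements at \<open>x\<close> is \<open>\<parallel>P\<^sub>x (cnj f)\<parallel>\<^sup>2\<close>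
  (lemma \<open>local_frame_has_sum\<close>), and the sum over \<open>x\<close> is
  \<open>\<parallel>cnj f\<parallel>\<^sup>2 = \<parallel>f\<parallel>\<^sup>2\<close>.

  Two points about the geometry need work.  Normal coordinates are a chart of the maximal atlas
  (lemma \<open>normal_chart\<close>), so that the formula for the Riemannian measure applies to them.  The
  density \<open>\<theta>\<close> does not vanish (lemma \<open>det_metric_matrix_nonzero\<close>): coordinate vectors are
  derivations of the algebra of global smooth functions, and their linear independence is shown with
  a smooth bump function.  Smoothness of the frame elements follows from the closure of the class
  \<open>C\<^sup>m\<close> under products and compositions, and from extension by zero.\<close>

section \<open>Calculus of functions of class \<open>C\<^sup>m\<close>\<close>

lemma iter_deriv_snoc:
  "iter_deriv (bs @ [b]) f = iter_deriv bs (\<lambda>x. frechet_derivative f (at x) b)"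
  by (induction bs) auto

text \<open>The lemmas on \<open>C\<^sup>m\<close> functions are proved by induction for finite \<open>m\<close>; this equivalence
  covers the case \<open>m = \<infinity>\<close>.\<close>

lemma Cm_on_iff_enat: "Cm_on m S f \<longleftrightarrow> (\<forall>n. enat n \<le> m \<longrightarrow> Cm_on (enat n) S f)"
proof
  assume "Cm_on m S f"
  then show "\<forall>n. enat n \<le> m \<longrightarrow> Cm_on (enat n) S f"
    unfolding Cm_on_def by (blast intro: order_trans less_le_trans)
next
  assume R: "\<forall>n. enat n \<le> m \<longrightarrow> Cm_on (enat n) S f"
  show "Cm_on m S f"
    unfolding Cm_on_def
  proof (intro conjI allI impI)
    fix bs :: "'a list" assume bs: "set bs \<subseteq> Basis \<and> enat (length bs) \<le> m"
    then have "Cm_on (enat (length bs)) S f" using R by blast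
    then show "continuous_on S (iter_deriv bs f)" using bs unfolding Cm_on_def by blast
  next
    fix bs :: "'a list" assume bs: "set bs \<subseteq> Basis \<and> enat (length bs) < m"
    then have "Cm_on (enat (Suc (length bs))) S f" using R by (metis Suc_ile_eq)
    moreover have "enat (length bs) < enat (Suc (length bs))" by simp
    ultimately show "\<forall>x\<in>S. iter_deriv bs f differentiable at x"
      using bs unfolding Cm_on_def by blast
  qed
qed

lemma Cm_on_le: "Cm_on m S f \<Longrightarrow> n \<le> m \<Longrightarrow> Cm_on n S f"
  unfolding Cm_on_iff_enat[of m] Cm_on_iff_enat[of n] by (meson order_trans)

lemma Cm_on_subset: "Cm_on m S f \<Longrightarrow> T \<subseteq> S \<Longrightarrow> Cm_on m T f"
  unfolding Cm_on_def by (blast intro: continuous_on_subset)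

lemma Cm_on_0: "Cm_on (enat 0) S f \<longleftrightarrow> continuous_on S f"
  unfolding Cm_on_def by (auto simp: zero_enat_def[symmetric] enat_0_iff)

lemma Cm_on_continuous: "Cm_on m S f \<Longrightarrow> continuous_on S f"
  using Cm_on_le[of m S f "enat 0"] Cm_on_0 by (metis i0_lb zero_enat_def)

text \<open>The recursion behind these inductions.  In \<^const>\<open>iter_deriv\<close> the last direction of the list
  is differentiated first, so it is split off at that end.\<close>

lemma Cm_on_Suc:
  "Cm_on (enat (Suc n)) S f \<longleftrightarrow> (\<forall>x\<in>S. f differentiable at x) \<and>
     (\<forall>b\<in>Basis. Cm_on (enat n) S (\<lambda>x. frechet_derivative f (at x) b))" (is "?L \<longleftrightarrow> ?R")
proof
  assume L: ?L
  then have c: "\<And>bs. set bs \<subseteq> Basis \<Longrightarrow> length bs \<le> Suc n \<Longrightarrow> continuous_on S (iter_deriv bs f)"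
    and d: "\<And>bs x. set bs \<subseteq> Basis \<Longrightarrow> length bs < Suc n \<Longrightarrow> x \<in> S \<Longrightarrow>
      iter_deriv bs f differentiable at x"
    unfolding Cm_on_def by auto
  show ?R
  proof (intro conjI ballI)
    fix x assume "x \<in> S" then show "f differentiable at x" using d[of "[]"] by simp
  next
    fix b :: 'a assume "b \<in> Basis"
    then show "Cm_on (enat n) S (\<lambda>x. frechet_derivative f (at x) b)"
      unfolding Cm_on_def using c[of "_ @ [b]"] d[of "_ @ [b]"]
      by (auto simp: iter_deriv_snoc)
  qed
next
  assume R: ?R
  show ?L
    unfolding Cm_on_def
  proof (intro conjI allI impI ballI)
    fix bs :: "'a list" assume bs: "set bs \<subseteq> Basis \<and> enat (length bs) \<le> enat (Suc n)"
    show "continuous_on S (iter_deriv bs f)"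
    proof (cases bs rule: rev_cases)
      case Nil
      then show ?thesis using R
        by (simp add: continuous_at_imp_continuous_on differentiable_imp_continuous_within)
    next
      case (snoc cs b)
      then show ?thesis using R bs by (auto simp: Cm_on_def iter_deriv_snoc)
    qed
  next
    fix bs :: "'a list" and x
    assume bs: "set bs \<subseteq> Basis \<and> enat (length bs) < enat (Suc n)" and x: "x \<in> S"
    show "iter_deriv bs f differentiable at x"
    proof (cases bs rule: rev_cases)
      case Nil
      then show ?thesis using R x by simp
    next
      case (snoc cs b)
      then show ?thesis using R bs x by (auto simp: Cm_on_def iter_deriv_snoc)
    qed
  qed
qed

lemma Cm_on_cong:
  assumes "open S" "Cm_on m S f" "\<And>x. x \<in> S \<Longrightarrow> f x = h x"
  shows "Cm_on m S h"
proof -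
  have "Cm_on (enat n) S h" if "Cm_on (enat n) S f" "\<And>x. x \<in> S \<Longrightarrow> f x = h x" for n f h
    using that
  proof (induction n arbitrary: f h)
    case 0
    then show ?case unfolding Cm_on_0 using continuous_on_cong[of S S f h] by simp
  next
    case (Suc n)
    have "h differentiable at x" if x: "x \<in> S" for x
    proof -
      obtain D where "(f has_derivative D) (at x)"
        using Suc.prems(1) x unfolding Cm_on_Suc differentiable_def by blast
      then have "(h has_derivative D) (at x)"
        by (rule has_derivative_transform_within_open[OF _ \<open>open S\<close> x Suc.prems(2)])
      then show ?thesis unfolding differentiable_def by blast
    qed
    moreover have eq: "frechet_derivative f (at x) = frechet_derivative h (at x)"
      if x: "x \<in> S" for x
      using Suc.prems x \<open>open S\<close> frechet_derivative_transform_within_open[of f x S h]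
      unfolding Cm_on_Suc by blast
    moreover have "Cm_on (enat n) S (\<lambda>x. frechet_derivative h (at x) b)" if "b \<in> Basis" for b
      by (rule Suc.IH[of "\<lambda>x. frechet_derivative f (at x) b"])
        (use Suc.prems(1) that eq in \<open>auto simp: Cm_on_Suc\<close>)
    ultimately show ?case
      unfolding Cm_on_Suc by simp
  qed
  with assms show ?thesis unfolding Cm_on_iff_enat[of m] by blast
qed

lemma Cm_on_SucI:
  assumes "open S" "\<And>x. x \<in> S \<Longrightarrow> (f has_derivative f' x) (at x)"
    "\<And>b. b \<in> Basis \<Longrightarrow> Cm_on (enat n) S (\<lambda>x. f' x b)"
  shows "Cm_on (enat (Suc n)) S f"
  unfolding Cm_on_Suc
proof (intro conjI ballI)
  fix x assume "x \<in> S" then show "f differentiable at x"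
    using assms(2) differentiable_def by blast
next
  fix b :: 'a assume "b \<in> Basis"
  then show "Cm_on (enat n) S (\<lambda>x. frechet_derivative f (at x) b)"
  proof (rule Cm_on_cong[OF assms(1) assms(3)])
    fix x assume "x \<in> S"
    from frechet_derivative_at[OF assms(2)[OF this]]
    show "f' x b = frechet_derivative f (at x) b" by simp
  qed
qed

lemma Cm_on_SucD:
  assumes "Cm_on (enat (Suc n)) S f"
  shows "\<And>x. x \<in> S \<Longrightarrow> (f has_derivative frechet_derivative f (at x)) (at x)"
    and "\<And>b. b \<in> Basis \<Longrightarrow> Cm_on (enat n) S (\<lambda>x. frechet_derivative f (at x) b)"
    and "Cm_on (enat n) S f"
proof -
  show "Cm_on (enat n) S f" by (rule Cm_on_le[OF assms]) simp
qed (use assms in \<open>simp_all add: Cm_on_Suc frechet_derivative_works\<close>)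

lemma Cm_on_has_derivative:
  assumes "Cm_on m S f" "1 \<le> m" "x \<in> S"
  shows "(f has_derivative frechet_derivative f (at x)) (at x)"
proof -
  have "Cm_on (enat (Suc 0)) S f"
    using Cm_on_le[OF assms(1,2)] unfolding one_enat_def One_nat_def .
  then show ?thesis using Cm_on_SucD(1) assms(3) by blast
qed

lemma Cm_on_Un:
  assumes "open S" "open T" "Cm_on m S f" "Cm_on m T f"
  shows "Cm_on m (S \<union> T) f"
  unfolding Cm_on_def
proof (intro conjI allI impI ballI)
  fix bs :: "'a list" assume "set bs \<subseteq> Basis \<and> enat (length bs) \<le> m"
  then show "continuous_on (S \<union> T) (iter_deriv bs f)"
    using assms continuous_on_open_Un[of S T "iter_deriv bs f"] unfolding Cm_on_def by simp
next
  fix bs :: "'a list" and x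
  assume "set bs \<subseteq> Basis \<and> enat (length bs) < m" "x \<in> S \<union> T"
  then show "iter_deriv bs f differentiable at x"
    using assms(3,4) unfolding Cm_on_def by (elim UnE) simp_all
qed

lemma Cm_on_const: "Cm_on m S (\<lambda>x. c)"
proof -
  have "Cm_on (enat n) UNIV (\<lambda>x. c)" for n
  proof (induction n arbitrary: c)
    case 0 show ?case by (simp add: Cm_on_0)
  next
    case (Suc n)
    show ?case
      by (rule Cm_on_SucI[where f' = "\<lambda>x b. 0"]) (simp_all add: Suc)
  qed
  then have "Cm_on m UNIV (\<lambda>x. c)" unfolding Cm_on_iff_enat[of m] by blast
  then show ?thesis by (rule Cm_on_subset) simp
qed

lemma Cm_on_bounded_linear_comp:
  assumes L: "bounded_linear L" and S: "open S" and f: "Cm_on m S f"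
  shows "Cm_on m S (\<lambda>x. L (f x))"
proof -
  have "Cm_on (enat n) S (\<lambda>x. L (f x))" if "Cm_on (enat n) S f" for n f
    using that
  proof (induction n arbitrary: f)
    case 0 then show ?case
      unfolding Cm_on_0 by (rule bounded_linear.continuous_on[OF L])
  next
    case (Suc n)
    show ?case
      by (rule Cm_on_SucI[OF S bounded_linear.has_derivative[OF L Cm_on_SucD(1)[OF Suc.prems]]])
        (assumption | rule Suc.IH Cm_on_SucD(2)[OF Suc.prems])+
  qed
  with f show ?thesis unfolding Cm_on_iff_enat[of m] by blast
qed

lemma Cm_on_ident: "Cm_on m S (\<lambda>x. x)"
proof -
  have "Cm_on (enat n) UNIV (\<lambda>x::'a. x)" for n
  proof (cases n)
    case 0 then show ?thesis by (simp add: Cm_on_0)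
  next
    case (Suc n)
    show ?thesis unfolding Suc
      by (rule Cm_on_SucI[where f' = "\<lambda>x b. b"]) (auto intro: Cm_on_const)
  qed
  then have "Cm_on m UNIV (\<lambda>x::'a. x)" unfolding Cm_on_iff_enat[of m] by blast
  then show ?thesis by (rule Cm_on_subset) simp
qed

lemma Cm_on_bounded_linear:
  assumes "bounded_linear L" shows "Cm_on m S L"
  by (rule Cm_on_subset[OF Cm_on_bounded_linear_comp[OF assms open_UNIV Cm_on_ident]]) simp

lemma Cm_on_add:
  assumes S: "open S" and "Cm_on m S f" "Cm_on m S h"
  shows "Cm_on m S (\<lambda>x. f x + h x)"
proof -
  have "Cm_on (enat n) S (\<lambda>x. f x + h x)" if "Cm_on (enat n) S f" "Cm_on (enat n) S h" for n f h
    using that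
  proof (induction n arbitrary: f h)
    case 0 then show ?case unfolding Cm_on_0 by (rule continuous_on_add)
  next
    case (Suc n)
    note f = Cm_on_SucD[OF Suc.prems(1)] and h = Cm_on_SucD[OF Suc.prems(2)]
    show ?case
      by (rule Cm_on_SucI[OF S has_derivative_add[OF f(1) h(1)]])
        (assumption | rule Suc.IH f(2) h(2))+
  qed
  with assms show ?thesis unfolding Cm_on_iff_enat[of m] by blast
qed

lemma Cm_on_sum:
  assumes S: "open S" and "\<And>i. i \<in> I \<Longrightarrow> Cm_on m S (f i)"
  shows "Cm_on m S (\<lambda>x. \<Sum>i\<in>I. f i x)"
  using assms(2)
proof (induction I rule: infinite_finite_induct)
  case (insert i I)
  then show ?case by (simp add: Cm_on_add[OF S])
qed (simp_all add: Cm_on_const)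

lemma Cm_on_bilinear:
  assumes B: "bounded_bilinear B" and S: "open S" and "Cm_on m S f" "Cm_on m S h"
  shows "Cm_on m S (\<lambda>x. B (f x) (h x))"
proof -
  have "Cm_on (enat n) S (\<lambda>x. B (f x) (h x))"
    if "Cm_on (enat n) S f" "Cm_on (enat n) S h" for n f h
    using that
  proof (induction n arbitrary: f h)
    case 0 then show ?case
      unfolding Cm_on_0 by (rule bounded_bilinear.continuous_on[OF B])
  next
    case (Suc n)
    note f = Cm_on_SucD[OF Suc.prems(1)] and h = Cm_on_SucD[OF Suc.prems(2)]
    show ?case
      by (rule Cm_on_SucI[OF S bounded_bilinear.FDERIV[OF B f(1) h(1)]])
        (assumption | rule Cm_on_add[OF S] Suc.IH f(2,3) h(2,3))+
  qed
  with assms show ?thesis unfolding Cm_on_iff_enat[of m] by blast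
qed

lemmas Cm_on_mult = Cm_on_bilinear[OF bounded_bilinear_mult]
  and Cm_on_scaleR = Cm_on_bilinear[OF bounded_bilinear_scaleR]
  and Cm_on_inner = Cm_on_bilinear[OF bounded_bilinear_inner]

lemma Cm_on_prod:
  fixes f :: "'i \<Rightarrow> 'e::euclidean_space \<Rightarrow> real"
  assumes S: "open S" and "\<And>i. i \<in> I \<Longrightarrow> Cm_on m S (f i)"
  shows "Cm_on m S (\<lambda>x. \<Prod>i\<in>I. f i x)"
  using assms(2)
proof (induction I rule: infinite_finite_induct)
  case (insert i I)
  then show ?case by (simp add: Cm_on_mult[OF S])
qed (simp_all add: Cm_on_const)

text \<open>By the chain rule \<open>\<partial>\<^sub>b (f \<circ> h)\<close> is the sum of the products of \<open>\<partial>\<^sub>c f \<circ> h\<close> with the \<open>c\<close>-component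
  of \<open>\<partial>\<^sub>b h\<close>, to which the induction hypothesis applies; \<open>f\<close> varies in the induction and \<open>h\<close>
  is fixed.\<close>

lemma Cm_on_compose:
  fixes f :: "'e::euclidean_space \<Rightarrow> 'b::real_normed_vector" and h :: "'c::euclidean_space \<Rightarrow> 'e"
  assumes S: "open S" and T: "open T" and "Cm_on m T f" "Cm_on m S h" "h ` S \<subseteq> T"
  shows "Cm_on m S (\<lambda>x. f (h x))"
proof -
  have "Cm_on (enat n) S (\<lambda>x. f (h x))"
    if "Cm_on (enat n) T f" "Cm_on (enat n) S h" for n and f :: "'e \<Rightarrow> 'b"
    using that
  proof (induction n arbitrary: f)
    case 0 then show ?case
      unfolding Cm_on_0 
      using \<open>h ` S \<subseteq> T\<close> continuous_on_compose2[of T f S h] by blast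
  next
    case (Suc n)
    note f = Cm_on_SucD[OF Suc.prems(1)] and h = Cm_on_SucD[OF Suc.prems(2)]
    let ?D = "\<lambda>x. frechet_derivative f (at (h x))" and ?h = "\<lambda>x. frechet_derivative h (at x)"
    show ?case
    proof (rule Cm_on_SucI[OF S])
      fix x assume x: "x \<in> S"
      then have "h x \<in> T" using \<open>h ` S \<subseteq> T\<close> by blast
      from has_derivative_compose[OF h(1)[OF x] f(1)[OF this]]
      show "((\<lambda>x. f (h x)) has_derivative (\<lambda>v. ?D x (?h x v))) (at x)" .
    next
      fix b :: 'c assume b: "b \<in> Basis"
      have "Cm_on (enat n) S (\<lambda>x. \<Sum>c\<in>Basis. (?h x b \<bullet> c) *\<^sub>R ?D x c)"
        by (intro Cm_on_sum[OF S] Cm_on_scaleR[OF S] Cm_on_inner[OF S] h(2) b Cm_on_const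
            Suc.IH f(2) h(3))
      then show "Cm_on (enat n) S (\<lambda>x. ?D x (?h x b))"
      proof (rule Cm_on_cong[OF S])
        fix x assume x: "x \<in> S"
        then have "h x \<in> T" using \<open>h ` S \<subseteq> T\<close> by blast
        then have lin: "linear (?D x)" using f(1) has_derivative_linear by blast
        have "?D x (?h x b) = ?D x (\<Sum>c\<in>Basis. (?h x b \<bullet> c) *\<^sub>R c)"
          by (simp add: euclidean_representation)
        also have "\<dots> = (\<Sum>c\<in>Basis. (?h x b \<bullet> c) *\<^sub>R ?D x c)"
          by (simp add: linear_sum[OF lin] linear_scale[OF lin])
        finally show "(\<Sum>c\<in>Basis. (?h x b \<bullet> c) *\<^sub>R ?D x c) = ?D x (?h x b)" by simp
      qed
    qed
  qed
  with assms show ?thesis unfolding Cm_on_iff_enat[of m] by blast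
qed

lemma Cm_on_SucI_real:
  fixes f :: "real \<Rightarrow> real"
  assumes "open S" "\<And>x. x \<in> S \<Longrightarrow> (f has_real_derivative f' x) (at x)" "Cm_on (enat n) S f'"
  shows "Cm_on (enat (Suc n)) S f"
  by (rule Cm_on_SucI[OF assms(1) has_field_derivative_imp_has_derivative[OF assms(2)]])
    (use assms(3) in auto)

lemma Cm_on_powr:
  fixes a :: real
  shows "Cm_on m {0<..} (\<lambda>t. t powr a)"
proof -
  have "Cm_on (enat n) {0<..} (\<lambda>t. t powr a)" for n and a :: real
  proof (induction n arbitrary: a)
    case 0 show ?case unfolding Cm_on_0 by (intro continuous_intros) auto
  next
    case (Suc n)
    show ?case
      by (rule Cm_on_SucI_real[where f' = "\<lambda>t. a * t powr (a - 1)"])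
        (auto intro!: Cm_on_mult Cm_on_const Suc.IH has_real_derivative_powr)
  qed
  then show ?thesis unfolding Cm_on_iff_enat[of m] by blast
qed

text \<open>The derivative of \<open>exp_bump t / t ^ k\<close> is a linear combination of two functions of the
  same family, also at \<open>0\<close>, where all of these functions vanish faster than any power
  (their value there is \<open>0\<close>, since \<open>exp_bump 0 = 0\<close>).
  Smoothness is hence proved by induction for the whole family at once.\<close>

lemma tendsto_power_exp_bump: "((\<lambda>t. exp_bump t / t ^ k) \<longlongrightarrow> 0) (at 0)"
proof -
  have "((\<lambda>x. x ^ k / exp x) \<longlongrightarrow> 0) (at_top::real filter)"
    by (rule tendsto_power_div_exp_0)
  then have "((\<lambda>t. inverse t ^ k / exp (inverse t)) \<longlongrightarrow> (0::real)) (at_right 0)"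
    by (rule filterlim_compose[OF _ filterlim_inverse_at_top_right])
  moreover have "\<forall>\<^sub>F t in at_right 0. inverse t ^ k / exp (inverse t) = exp_bump t / t ^ k"
    by (rule eventually_at_rightI[of 0 1])
      (auto simp: exp_bump_def exp_minus field_simps)
  ultimately have "((\<lambda>t. exp_bump t / t ^ k) \<longlongrightarrow> 0) (at_right 0)"
    by (rule Lim_transform_eventually)
  moreover have "((\<lambda>t. exp_bump t / t ^ k) \<longlongrightarrow> 0) (at_left 0)"
  proof -
    have "\<forall>\<^sub>F t in at_left 0. 0 = exp_bump t / t ^ k"
      by (rule eventually_at_leftI[of "-1"]) (auto simp: exp_bump_def)
    then show ?thesis by (rule Lim_transform_eventually[OF tendsto_const])
  qed
  ultimately show ?thesis by (simp add: filterlim_at_split)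
qed

lemma exp_bump_has_derivative:
  "((\<lambda>t. exp_bump t / t ^ k) has_real_derivative
     exp_bump t / t ^ (k + 2) - real k * (exp_bump t / t ^ (k + 1))) (at t)"
proof (cases t "0::real" rule: linorder_cases)
  case greater
  define i where "i = inverse t"
  have "((\<lambda>t. exp (- inverse t)) has_real_derivative exp (- i) * (i * i)) (at t)"
    using greater by (auto intro!: derivative_eq_intros simp: i_def)
  moreover have "((\<lambda>t. inverse t ^ k) has_real_derivative - (real k * i ^ (k + 1))) (at t)"
  proof -
    have "(inverse has_real_derivative - (i * i)) (at t)"
      using DERIV_inverse[of t UNIV] greater by (simp add: i_def power2_eq_square)
    from DERIV_power[OF this, of k] show ?thesis
      by (cases k) (simp_all add: i_def mult_ac)
  qed
  ultimately have "((\<lambda>t. exp (- inverse t) * inverse t ^ k) has_real_derivative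
      exp (- i) * (i * i) * inverse t ^ k + - (real k * i ^ (k + 1)) * exp (- inverse t)) (at t)"
    by (rule DERIV_mult)
  then have "((\<lambda>t. exp_bump t / t ^ k) has_real_derivative
      exp (- i) * (i * i) * inverse t ^ k + - (real k * i ^ (k + 1)) * exp (- inverse t)) (at t)"
    by (rule has_field_derivative_transform_within_open[of _ _ _ "{0<..}"])
      (use greater in \<open>auto simp: exp_bump_def divide_inverse power_inverse\<close>)
  then show ?thesis using greater
    by (simp add: exp_bump_def i_def divide_inverse power_inverse[symmetric] mult_ac)
next
  case less
  have "((\<lambda>t. exp_bump t / t ^ k) has_real_derivative 0) (at t)"
    by (rule has_field_derivative_transform_within_open[OF DERIV_const, of "{..<0}"])
      (use less in \<open>auto simp: exp_bump_def\<close>)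
  then show ?thesis using less by (simp add: exp_bump_def)
next
  case equal
  have "(\<lambda>h. ((exp_bump (0 + h) / (0 + h) ^ k) - exp_bump 0 / 0 ^ k) / h) =
      (\<lambda>h. exp_bump h / h ^ (k + 1))"
    by (auto simp: exp_bump_def)
  then have "((\<lambda>t. exp_bump t / t ^ k) has_real_derivative 0) (at 0)"
    unfolding DERIV_def using tendsto_power_exp_bump[of "k + 1"] by simp
  then show ?thesis using equal by (simp add: exp_bump_def)
qed

lemma Cm_on_exp_bump: "Cm_on m UNIV exp_bump"
proof -
  have "Cm_on (enat n) UNIV (\<lambda>t. exp_bump t / t ^ k)" for n k
  proof (induction n arbitrary: k)
    case 0
    show ?case unfolding Cm_on_0
      by (rule continuous_at_imp_continuous_on) (use DERIV_isCont[OF exp_bump_has_derivative] in blast)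
  next
    case (Suc n)
    have "Cm_on (enat n) UNIV (\<lambda>t. exp_bump t / t ^ (k + 2) +
        - real k * (exp_bump t / t ^ (k + 1)))"
      by (intro Cm_on_add Cm_on_mult Cm_on_const Suc.IH open_UNIV)
    then show ?case
      by (intro Cm_on_SucI_real[OF open_UNIV exp_bump_has_derivative]) simp
  qed
  from this[of _ 0] show ?thesis unfolding Cm_on_iff_enat[of m] by simp
qed

section \<open>Smooth functions and tangent vectors on a manifold\<close>

text \<open>Functions of class \<open>C\<^sup>m\<close> on an open subset \<open>W\<close> of the manifold.\<close>

definition Cm_fun_on ::
  "('a::topological_space, 'e::euclidean_space) chart set \<Rightarrow> enat \<Rightarrow> 'a set \<Rightarrow>
   ('a \<Rightarrow> 'b::real_normed_vector) \<Rightarrow> bool" where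
  "Cm_fun_on A m W f \<longleftrightarrow> (\<forall>(U, \<phi>)\<in>A. Cm_on m (\<phi> ` (U \<inter> W)) (f \<circ> inv_into U \<phi>))"

lemma Cm_fun_on_UNIV: "Cm_fun_on A m UNIV f = Cm_fun A m f"
  by (simp add: Cm_fun_on_def Cm_fun_def)

lemma is_chartD:
  assumes "is_chart (U, \<phi>)"
  shows "open U" "open (\<phi> ` U)" "inj_on \<phi> U" "continuous_on U \<phi>"
    "continuous_on (\<phi> ` U) (inv_into U \<phi>)"
proof -
  from assms have h: "homeomorphism U (\<phi> ` U) \<phi> (inv_into U \<phi>)"
    and o: "open U" "open (\<phi> ` U)"
    by (auto simp: is_chart_def)
  show "open U" "open (\<phi> ` U)" by fact+
  show "inj_on \<phi> U" by (rule inj_on_inverseI) (rule homeomorphism_apply1[OF h])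
  show "continuous_on U \<phi>" "continuous_on (\<phi> ` U) (inv_into U \<phi>)"
    using h by (simp_all add: homeomorphism_def)
qed

lemma open_chart_image:
  assumes "is_chart (U, \<phi>)" "open W"
  shows "open (\<phi> ` (U \<inter> W))"
proof -
  have "homeomorphism U (\<phi> ` U) \<phi> (inv_into U \<phi>)" "open U" "open (\<phi> ` U)"
    using assms(1) by (auto simp: is_chart_def)
  moreover have "openin (top_of_set U) (U \<inter> W)" using assms(2) by (simp add: openin_open_Int)
  ultimately have "openin (top_of_set (\<phi> ` U)) (\<phi> ` (U \<inter> W))"
    by (intro homeomorphism_imp_open_map)
  then show ?thesis using \<open>open (\<phi> ` U)\<close> by (simp add: openin_open_eq)
qed

lemma inv_into_image_Int:
  assumes "inj_on \<phi> U" "y \<in> \<phi> ` (U \<inter> W)"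
  shows "inv_into U \<phi> y \<in> U \<inter> W" "\<phi> (inv_into U \<phi> y) = y"
  using assms by (auto simp: inv_into_f_f)

lemma smooth_structureD:
  assumes "smooth_structure A" "(U, \<phi>) \<in> A"
  shows "is_chart (U, \<phi>)"
    and "(V, \<psi>) \<in> A \<Longrightarrow> Cm_on \<infinity> (\<phi> ` (U \<inter> V)) (\<psi> \<circ> inv_into U \<phi>)"
proof -
  note H = assms(1)[unfolded smooth_structure_def]
  note * = H[THEN conjunct1] H[THEN conjunct2, THEN conjunct2, THEN conjunct1]
  show "is_chart (U, \<phi>)" using *(1) assms(2) by (rule bspec)
  show "Cm_on \<infinity> (\<phi> ` (U \<inter> V)) (\<psi> \<circ> inv_into U \<phi>)" if "(V, \<psi>) \<in> A"
    using bspec[OF bspec[OF *(2) assms(2)] that] by (simp add: smooth_transition_def)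
qed

lemma Cm_fun_on_cong:
  assumes A: "smooth_structure A" and W: "open W" and f: "Cm_fun_on A m W f"
    and eq: "\<And>u. u \<in> W \<Longrightarrow> f u = h u"
  shows "Cm_fun_on A m W h"
  unfolding Cm_fun_on_def
proof (safe)
  fix U and \<phi> :: "'a \<Rightarrow> 'b" assume c: "(U, \<phi>) \<in> A"
  note ch = smooth_structureD(1)[OF A c]
  show "Cm_on m (\<phi> ` (U \<inter> W)) (h \<circ> inv_into U \<phi>)"
  proof (rule Cm_on_cong[OF open_chart_image[OF ch W]])
    show "Cm_on m (\<phi> ` (U \<inter> W)) (f \<circ> inv_into U \<phi>)"
      using f c by (auto simp: Cm_fun_on_def)
  qed (use inv_into_image_Int(1)[OF is_chartD(3)[OF ch]] eq in auto)
qed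

lemma Cm_fun_on_Un:
  assumes A: "smooth_structure A" and "open V" "open W" "Cm_fun_on A m V f" "Cm_fun_on A m W f"
  shows "Cm_fun_on A m (V \<union> W) f"
  unfolding Cm_fun_on_def
proof (safe)
  fix U and \<phi> :: "'a \<Rightarrow> 'b" assume c: "(U, \<phi>) \<in> A"
  note op = open_chart_image[OF smooth_structureD(1)[OF A c]]
  have "Cm_on m (\<phi> ` (U \<inter> V) \<union> \<phi> ` (U \<inter> W)) (f \<circ> inv_into U \<phi>)"
    by (rule Cm_on_Un) (use assms c op in \<open>auto simp: Cm_fun_on_def\<close>)
  then show "Cm_on m (\<phi> ` (U \<inter> (V \<union> W))) (f \<circ> inv_into U \<phi>)"
    by (simp add: Int_Un_distrib image_Un)
qed

lemma Cm_fun_on_const: "Cm_fun_on A m W (\<lambda>u. c)"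
  unfolding Cm_fun_on_def o_def using Cm_on_const by auto

lemma Cm_fun_on_bilinear:
  assumes A: "smooth_structure A" and W: "open W" and B: "bounded_bilinear B"
    and f: "Cm_fun_on A m W f" and h: "Cm_fun_on A m W h"
  shows "Cm_fun_on A m W (\<lambda>u. B (f u) (h u))"
  unfolding Cm_fun_on_def o_def
proof safe
  fix U and \<phi> :: "'a \<Rightarrow> 'b" assume c: "(U, \<phi>) \<in> A"
  show "Cm_on m (\<phi> ` (U \<inter> W)) (\<lambda>y. B (f (inv_into U \<phi> y)) (h (inv_into U \<phi> y)))"
    by (rule Cm_on_bilinear[OF B open_chart_image[OF smooth_structureD(1)[OF A c] W]])
      (use f h c in \<open>auto simp: Cm_fun_on_def o_def\<close>)
qed

lemma Cm_fun_on_sum: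
  assumes A: "smooth_structure A" and W: "open W"
    and f: "\<And>i. i \<in> I \<Longrightarrow> Cm_fun_on A m W (f i)"
  shows "Cm_fun_on A m W (\<lambda>u. \<Sum>i\<in>I. f i u)"
  unfolding Cm_fun_on_def o_def
proof safe
  fix U and \<phi> assume c: "(U, \<phi>) \<in> A"
  show "Cm_on m (\<phi> ` (U \<inter> W)) (\<lambda>y. \<Sum>i\<in>I. f i (inv_into U \<phi> y))"
    by (rule Cm_on_sum[OF open_chart_image[OF smooth_structureD(1)[OF A c] W]])
      (use f c in \<open>auto simp: Cm_fun_on_def o_def\<close>)
qed

text \<open>Since transition maps are smooth, a function that is \<open>C\<^sup>m\<close> in one chart is so in all of
  them.\<close>

lemma Cm_fun_on_chart:
  assumes A: "smooth_structure A" and c: "(V, \<psi>) \<in> A" and W: "open W" "W \<subseteq> V"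
    and h: "Cm_on m T h" "open T" "\<psi> ` W \<subseteq> T"
  shows "Cm_fun_on A m W (\<lambda>u. h (\<psi> u))"
  unfolding Cm_fun_on_def o_def
proof safe
  fix U and \<phi> :: "'a \<Rightarrow> 'b" assume U: "(U, \<phi>) \<in> A"
  note ch = smooth_structureD(1)[OF A U]
  have "Cm_on m (\<phi> ` (U \<inter> W)) (\<psi> \<circ> inv_into U \<phi>)"
    by (rule Cm_on_subset[OF Cm_on_le[OF smooth_structureD(2)[OF A U c]]]) (use W in auto)
  then show "Cm_on m (\<phi> ` (U \<inter> W)) (\<lambda>y. h (\<psi> (inv_into U \<phi> y)))"
    by (intro Cm_on_compose[OF open_chart_image[OF ch W(1)] h(2,1)])
      (use h(3) inv_into_image_Int(1)[OF is_chartD(3)[OF ch]] in \<open>auto simp: o_def\<close>)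
qed

lemma Cm_fun_extend_by_zero:
  assumes A: "smooth_structure A" and W: "open W" and f: "Cm_fun_on A m W f"
    and K: "closed K" "K \<subseteq> W" "\<And>u. u \<notin> K \<Longrightarrow> f u = 0"
  shows "Cm_fun A m f"
proof -
  have "Cm_fun_on A m (- K) f"
    by (rule Cm_fun_on_cong[OF A _ Cm_fun_on_const[of _ _ _ 0]]) (use K in auto)
  then have "Cm_fun_on A m (W \<union> - K) f"
    using Cm_fun_on_Un[OF A W _ f] K(1) by (simp add: open_Compl)
  moreover have "W \<union> - K = UNIV" using K(2) by auto
  ultimately show ?thesis by (simp add: Cm_fun_on_UNIV)
qed

lemma Cm_fun_chart_has_derivative:
  assumes "(U, \<phi>) \<in> A" "u \<in> U" "Cm_fun A \<infinity> f"
  shows "(f \<circ> inv_into U \<phi> has_derivative frechet_derivative (f \<circ> inv_into U \<phi>) (at (\<phi> u)))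
    (at (\<phi> u))"
  by (rule Cm_on_has_derivative[of \<infinity> "\<phi> ` U"]) (use assms in \<open>auto simp: Cm_fun_def\<close>)

lemma coord_vec_in_tangent_space:
  fixes A :: "('a::topological_space, real^'d) chart set"
  assumes A: "smooth_structure A" and c: "(U, \<phi>) \<in> A" and u: "u \<in> U"
  shows "coord_vec A (U, \<phi>) u i \<in> tangent_space A u"
proof -
  note ch = smooth_structureD(1)[OF A c]
  have inv: "inv_into U \<phi> (\<phi> u) = u" using is_chartD(3)[OF ch] u by simp
  let ?D = "\<lambda>f. frechet_derivative (f \<circ> inv_into U \<phi>) (at (\<phi> u))"
  have lin: "Cm_fun A \<infinity> (\<lambda>x. a * f x + b * h x)"
    "?D (\<lambda>x. a * f x + b * h x) (axis i 1) = a * ?D f (axis i 1) + b * ?D h (axis i 1)"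
    if "Cm_fun A \<infinity> f" "Cm_fun A \<infinity> h" for a b and f h :: "'a \<Rightarrow> real"
  proof -
    have "Cm_fun_on A \<infinity> UNIV (\<lambda>x. \<Sum>j\<in>{0, 1::nat}. (if j = 0 then a else b) * (if j = 0 then f x else h x))"
      by (intro Cm_fun_on_sum[OF A open_UNIV] Cm_fun_on_bilinear[OF A open_UNIV bounded_bilinear_mult]
          Cm_fun_on_const) (use that in \<open>auto simp: Cm_fun_on_UNIV\<close>)
    then show "Cm_fun A \<infinity> (\<lambda>x. a * f x + b * h x)"
      by (simp add: Cm_fun_on_UNIV)
    have "((\<lambda>y. a * (f \<circ> inv_into U \<phi>) y + b * (h \<circ> inv_into U \<phi>) y) has_derivative
        (\<lambda>v. a * ?D f v + b * ?D h v)) (at (\<phi> u))"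
      by (intro has_derivative_add has_derivative_mult_right
          Cm_fun_chart_has_derivative[OF c u] that)
    from frechet_derivative_at[OF this]
    show "?D (\<lambda>x. a * f x + b * h x) (axis i 1) = a * ?D f (axis i 1) + b * ?D h (axis i 1)"
      by (simp add: o_def fun_eq_iff)
  qed
  have prod: "Cm_fun A \<infinity> (\<lambda>x. f x * h x)"
    "?D (\<lambda>x. f x * h x) (axis i 1) = f u * ?D h (axis i 1) + h u * ?D f (axis i 1)"
    if "Cm_fun A \<infinity> f" "Cm_fun A \<infinity> h" for f h :: "'a \<Rightarrow> real"
  proof -
    show "Cm_fun A \<infinity> (\<lambda>x. f x * h x)"
      using Cm_fun_on_bilinear[OF A open_UNIV bounded_bilinear_mult, of \<infinity> f h] that
      by (simp add: Cm_fun_on_UNIV)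
    have "((\<lambda>y. (f \<circ> inv_into U \<phi>) y * (h \<circ> inv_into U \<phi>) y) has_derivative
        (\<lambda>v. (f \<circ> inv_into U \<phi>) (\<phi> u) * ?D h v + ?D f v * (h \<circ> inv_into U \<phi>) (\<phi> u))) (at (\<phi> u))"
      by (intro has_derivative_mult Cm_fun_chart_has_derivative[OF c u] that)
    from frechet_derivative_at[OF this]
    show "?D (\<lambda>x. f x * h x) (axis i 1) = f u * ?D h (axis i 1) + h u * ?D f (axis i 1)"
      by (simp add: o_def fun_eq_iff inv mult.commute)
  qed
  show ?thesis
    unfolding tangent_space_def coord_vec_def chart_partial_def by (simp add: lin prod)
qed

text \<open>Coordinate vectors are defined by their action on global smooth functions.  Their linear
  independence hence needs such a function with prescribed gradient at \<open>u\<close>: a radial bump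
  in the chart whose centre is shifted from \<open>u\<close> in the direction \<open>a\<close>.\<close>

lemma coord_vec_independent:
  fixes A :: "('a::t2_space, real^'d) chart set"
  assumes A: "smooth_structure A" and c: "(U, \<phi>) \<in> A" and u: "u \<in> U" and a: "a \<noteq> 0"
  shows "(\<lambda>f. \<Sum>i\<in>UNIV. a $ i * coord_vec A (U, \<phi>) u i f) \<noteq> (\<lambda>_. 0)"
proof -
  note ch = smooth_structureD(1)[OF A c]
  note chD = is_chartD[OF ch]
  define y where "y = \<phi> u"
  obtain e where e: "e > 0" "ball y e \<subseteq> \<phi> ` U"
    using chD(2) u unfolding y_def by (meson imageI openE)
  \<comment> \<open>The bump is centred at distance \<open>\<rho> / 2\<close> from \<open>y\<close> and has radius \<open>\<rho>\<close>, so that \<open>y\<close> lies inside its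
    support but is not its centre, and the support stays in the \<open>e\<close>-ball around \<open>y\<close>.\<close>
  define \<rho> where "\<rho> = e / 4"
  define t where "t = \<rho> / (2 * norm a)"
  define y0 where "y0 = y - t *\<^sub>R a"
  have t: "t > 0" "norm (t *\<^sub>R a) = \<rho> / 2" using e a by (auto simp: t_def \<rho>_def)
  have \<rho>: "\<rho> > 0" using e by (simp add: \<rho>_def)
  have cb: "cball y0 \<rho> \<subseteq> \<phi> ` U"
  proof
    fix z assume "z \<in> cball y0 \<rho>"
    then have "dist y0 z \<le> \<rho>" by simp
    moreover have "dist y y0 = \<rho> / 2" using t(2) by (simp add: y0_def dist_norm)
    ultimately have "dist y z < e" using \<rho> dist_triangle[of y z y0] by (simp add: \<rho>_def)
    then show "z \<in> \<phi> ` U" using e by auto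
  qed
  define b where "b z = exp_bump (\<rho>\<^sup>2 - (z - y0) \<bullet> (z - y0))" for z
  have b: "Cm_on \<infinity> UNIV b"
  proof -
    have q: "Cm_on \<infinity> UNIV (\<lambda>z. \<rho>\<^sup>2 + - 1 * ((z + - y0) \<bullet> (z + - y0)))"
      by (intro Cm_on_add Cm_on_mult Cm_on_inner Cm_on_const Cm_on_ident open_UNIV)
    have "Cm_on \<infinity> UNIV (\<lambda>z. exp_bump (\<rho>\<^sup>2 + - 1 * ((z + - y0) \<bullet> (z + - y0))))"
      by (rule Cm_on_compose[OF open_UNIV open_UNIV Cm_on_exp_bump q]) simp
    then show ?thesis by (simp add: b_def[abs_def])
  qed
  have b0: "b z = 0" if "z \<notin> cball y0 \<rho>" for z
  proof -
    have "\<rho> < norm (z - y0)" using that by (simp add: dist_norm norm_minus_commute)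
    then have "\<rho>\<^sup>2 < (norm (z - y0))\<^sup>2" using \<rho> by (intro power_strict_mono) auto
    then show ?thesis by (simp add: b_def exp_bump_def power2_norm_eq_inner)
  qed
  define f where "f v = (if v \<in> U then b (\<phi> v) else 0)" for v
  define K where "K = inv_into U \<phi> ` cball y0 \<rho>"
  have K: "closed K" "K \<subseteq> U"
  proof -
    have "compact K" unfolding K_def
      by (rule compact_continuous_image[OF continuous_on_subset[OF chD(5) cb] compact_cball])
    then show "closed K" by (rule compact_imp_closed)
    show "K \<subseteq> U" unfolding K_def using cb by (auto intro: inv_into_into)
  qed
  have f: "Cm_fun A \<infinity> f"
  proof (rule Cm_fun_extend_by_zero[OF A chD(1) _ K])
    have "Cm_fun_on A \<infinity> U (\<lambda>v. b (\<phi> v))"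
      by (rule Cm_fun_on_chart[OF A c chD(1) _ b]) auto
    then show "Cm_fun_on A \<infinity> U f"
      by (rule Cm_fun_on_cong[OF A chD(1)]) (simp add: f_def)
  next
    fix v assume v: "v \<notin> K"
    have "\<phi> v \<notin> cball y0 \<rho>" if "v \<in> U"
    proof
      assume "\<phi> v \<in> cball y0 \<rho>"
      then have "inv_into U \<phi> (\<phi> v) \<in> K" unfolding K_def by (rule imageI)
      with v that chD(3) show False by simp
    qed
    then show "f v = 0" using b0 by (auto simp: f_def)
  qed
  define E where "E = \<rho>\<^sup>2 - (t *\<^sub>R a) \<bullet> (t *\<^sub>R a)"
  have "(norm (t *\<^sub>R a))\<^sup>2 < \<rho>\<^sup>2" unfolding t(2) using \<rho> by (simp add: power2_eq_square)
  then have E: "E > 0" unfolding E_def power2_norm_eq_inner by linarith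
  \<comment> \<open>the derivative of \<^const>\<open>exp_bump\<close> at \<open>E\<close>\<close>
  let ?b' = "exp_bump E / E ^ 2"
  have "(exp_bump has_real_derivative ?b') (at E)"
    using exp_bump_has_derivative[of 0 E] by (simp add: numeral_2_eq_2)
  then have db: "(exp_bump has_derivative (\<lambda>h. ?b' * h)) (at E)"
    by (rule has_field_derivative_imp_has_derivative)
  have "((\<lambda>z. \<rho>\<^sup>2 - (z - y0) \<bullet> (z - y0)) has_derivative (\<lambda>v. - 2 * ((t *\<^sub>R a) \<bullet> v))) (at y)"
    by (auto intro!: derivative_eq_intros simp: y0_def fun_eq_iff inner_commute)
  moreover have "(exp_bump has_derivative (\<lambda>h. ?b' * h)) (at (\<rho>\<^sup>2 - (y - y0) \<bullet> (y - y0)))"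
    using db by (simp add: E_def y0_def)
  ultimately have Db: "(b has_derivative (\<lambda>v. ?b' * (- 2 * ((t *\<^sub>R a) \<bullet> v)))) (at y)"
    unfolding b_def[abs_def] by (rule has_derivative_compose)
  have "(f \<circ> inv_into U \<phi> has_derivative (\<lambda>v. ?b' * (- 2 * ((t *\<^sub>R a) \<bullet> v)))) (at y)"
  proof (rule has_derivative_transform_within_open[OF Db chD(2)])
    show "y \<in> \<phi> ` U" using u by (simp add: y_def)
    show "b z = (f \<circ> inv_into U \<phi>) z" if "z \<in> \<phi> ` U" for z
      using that chD(3) by (auto simp: f_def)
  qed
  note fd = frechet_derivative_at[OF this, symmetric]
  have D: "coord_vec A (U, \<phi>) u i f = ?b' * (- 2 * t * a $ i)" for i
    using f by (simp add: coord_vec_def chart_partial_def y_def[symmetric] fd inner_axis)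
  have "(\<Sum>i\<in>UNIV. a $ i * coord_vec A (U, \<phi>) u i f) = ?b' * (- 2 * t) * (a \<bullet> a)"
    unfolding D inner_vec_def sum_distrib_left by (intro sum.cong) (simp_all add: mult_ac)
  moreover have "\<dots> \<noteq> 0"
    using t(1) a E by (simp add: exp_bump_def)
  ultimately have "(\<Sum>i\<in>UNIV. a $ i * coord_vec A (U, \<phi>) u i f) \<noteq> 0" by simp
  then show ?thesis by (auto simp: fun_eq_iff)
qed

section \<open>Nondegeneracy of the metric matrix\<close>

lemma riemannian_metricD:
  assumes "riemannian_manifold A g" "v \<in> tangent_space A x" "w \<in> tangent_space A x"
    "z \<in> tangent_space A x"
  shows "g x v w = g x w v" "g x (lincomb a v b w) z = a * g x v z + b * g x w z"
    "v \<noteq> (\<lambda>_. 0) \<Longrightarrow> g x v v > 0"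
proof -
  note H = assms(1)[unfolded riemannian_manifold_def, THEN conjunct2, THEN conjunct1,
      rule_format, OF assms(2-4)]
  show "g x v w = g x w v" by (rule H[THEN conjunct1])
  show "g x (lincomb a v b w) z = a * g x v z + b * g x w z"
    by (rule H[THEN conjunct2, THEN conjunct1])
  show "v \<noteq> (\<lambda>_. 0) \<Longrightarrow> g x v v > 0"
    by (rule H[THEN conjunct2, THEN conjunct2, THEN mp])
qed

lemma tangent_space_lincomb:
  assumes "v \<in> tangent_space A x" "w \<in> tangent_space A x"
  shows "lincomb a v b w \<in> tangent_space A x"
  using assms unfolding tangent_space_def by (simp add: algebra_simps)

text \<open>Closure under finite linear combinations and linearity of the metric are proved together,
  because the metric is known to be linear on tangent vectors only.\<close>

lemma tangent_space_sum:
  assumes g: "riemannian_manifold A g"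
    and v: "\<And>i. i \<in> I \<Longrightarrow> v i \<in> tangent_space A x" and I: "finite I"
  shows "(\<lambda>f. \<Sum>i\<in>I. a i * v i f) \<in> tangent_space A x \<and>
    (\<forall>z\<in>tangent_space A x. g x (\<lambda>f. \<Sum>i\<in>I. a i * v i f) z = (\<Sum>i\<in>I. a i * g x (v i) z))"
  using I v
proof (induction I)
  case empty
  have "(\<lambda>_. 0) \<in> tangent_space A x" by (simp add: tangent_space_def)
  moreover have "g x (\<lambda>_. 0) z = 0" if "z \<in> tangent_space A x" for z
    using riemannian_metricD(2)[OF g \<open>(\<lambda>_. 0) \<in> tangent_space A x\<close>
        \<open>(\<lambda>_. 0) \<in> tangent_space A x\<close> that, of 0 0] by simp
  ultimately show ?case by simp
next
  case (insert i I)
  let ?s = "\<lambda>f. \<Sum>i\<in>I. a i * v i f"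
  have s: "?s \<in> tangent_space A x"
    "\<And>z. z \<in> tangent_space A x \<Longrightarrow> g x ?s z = (\<Sum>i\<in>I. a i * g x (v i) z)"
    using insert by auto
  have i: "v i \<in> tangent_space A x" using insert by simp
  have eq: "(\<lambda>f. \<Sum>i\<in>insert i I. a i * v i f) = lincomb (a i) (v i) 1 ?s"
    using insert by simp
  show ?case
    unfolding eq using tangent_space_lincomb[OF i s(1), of "a i" 1]
      riemannian_metricD(2)[OF g i s(1), of _ "a i" 1] s(2) insert(1,2) by simp
qed

text \<open>A vector \<open>a\<close> in the kernel of the metric matrix gives the tangent vector \<open>\<Sum>\<^sub>i a\<^sub>i \<partial>\<^sub>i\<close> of
  length \<open>0\<close>.\<close>

lemma det_metric_matrix_nonzero:
  fixes A :: "('a::t2_space, real^'d) chart set"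
  assumes g: "riemannian_manifold A g" and c: "(U, \<phi>) \<in> A" and u: "u \<in> U"
  shows "det (metric_matrix A g (U, \<phi>) u) \<noteq> 0"
proof
  let ?M = "metric_matrix A g (U, \<phi>) u" and ?e = "coord_vec A (U, \<phi>) u"
  have A: "smooth_structure A" using g by (simp add: riemannian_manifold_def)
  assume "det ?M = 0"
  then have "\<not> invertible ?M" by (simp add: invertible_det_nz)
  then obtain a where a: "?M *v a = 0" "a \<noteq> 0"
    unfolding invertible_left_inverse matrix_left_invertible_ker by blast
  let ?v = "\<lambda>f. \<Sum>i\<in>UNIV. a $ i * ?e i f"
  have e: "?e i \<in> tangent_space A u" for i by (rule coord_vec_in_tangent_space[OF A c u])
  have v: "?v \<in> tangent_space A u"
    and gv: "\<And>z. z \<in> tangent_space A u \<Longrightarrow> g u ?v z = (\<Sum>i\<in>UNIV. a $ i * g u (?e i) z)"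
    using tangent_space_sum[OF g, of UNIV ?e u "($) a"] e by auto
  have "g u ?v ?v = (\<Sum>i\<in>UNIV. a $ i * g u (?e i) ?v)" by (rule gv[OF v])
  also have "\<dots> = (\<Sum>i\<in>UNIV. a $ i * (?M *v a) $ i)"
  proof (intro sum.cong refl)
    fix i
    have "g u (?e i) ?v = g u ?v (?e i)" by (rule riemannian_metricD(1)[OF g e v v])
    also have "\<dots> = (\<Sum>j\<in>UNIV. a $ j * g u (?e j) (?e i))" by (rule gv[OF e])
    also have "\<dots> = (?M *v a) $ i"
      unfolding matrix_vector_mult_def metric_matrix_def
      by (simp add: riemannian_metricD(1)[OF g e e e, of _ i] mult.commute)
    finally show "a $ i * g u (?e i) ?v = a $ i * (?M *v a) $ i" by simp
  qed
  also have "\<dots> = 0" using a by simp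
  finally show False
    using riemannian_metricD(3)[OF g v v v coord_vec_independent[OF A c u a(2)]] by simp
qed

section \<open>Normal coordinates\<close>

lemma eucl_structure_id: "(UNIV, id) \<in> (eucl_structure :: ('e, 'e::euclidean_space) chart set)"
  unfolding eucl_structure_def is_chart_def smooth_transition_def
  by (auto simp: inv_id Cm_on_ident id_def[abs_def] o_def intro!: homeomorphismI)

text \<open>By maximality of the atlas, the normal coordinates on \<open>\<Omega>\<^sub>x(r(x))\<close> form a chart in it.  As
  \<open>i\<^sub>x\<close> is an isometry, the geodesic balls correspond to Euclidean balls in this chart.\<close>

lemma normal_chart:
  fixes A :: "('a::topological_space, real^'d) chart set"
  assumes g: "riemannian_manifold A g" and nr: "normal_radii A g r \<iota>"
  defines "\<Omega> \<equiv> \<lambda>x. geodesic_ball A g x (r x)" and "\<kappa> \<equiv> normal_coord A g r \<iota>"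
  shows "(\<Omega> x, \<kappa> x) \<in> A" "\<kappa> x ` \<Omega> x = ball 0 (r x)"
    "\<rho> \<le> r x \<Longrightarrow> geodesic_ball A g x \<rho> = {u \<in> \<Omega> x. \<kappa> x u \<in> ball 0 \<rho>}"
proof -
  \<comment> \<open>\<open>E\<close> is the exponential map in Euclidean coordinates, the inverse of \<open>\<kappa> x\<close>.\<close>
  define TS where "TS = tangent_space A x"
  define E0 where "E0 = inv_into TS (\<iota> x)"
  define E where "E = exp_map A g x \<circ> E0"
  note nrx = nr[unfolded normal_radii_def, THEN spec, of x]
  have iso: "tangent_isometry A g x (\<iota> x)"
    and diff: "diffeomorphism eucl_structure A (ball 0 (r x)) (\<Omega> x) E"
    using nrx by (simp_all add: E_def E0_def TS_def \<Omega>_def)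
  note bij = iso[unfolded tangent_isometry_def, folded TS_def, THEN conjunct1]
  have E0: "E0 y \<in> TS" "\<iota> x (E0 y) = y" for y
    using bij unfolding E0_def bij_betw_def
    by (simp_all add: inv_into_into f_inv_into_f)
  have E0i: "E0 (\<iota> x v) = v" if "v \<in> TS" for v
    using bij that unfolding E0_def bij_betw_def by simp
  have nrm: "sqrt (g x v v) = norm (\<iota> x v)" if "v \<in> TS" for v
    using iso that unfolding tangent_isometry_def TS_def norm_eq_sqrt_inner by simp
  have tb: "tangent_ball A g x \<rho> = E0 ` ball 0 \<rho>" for \<rho>
  proof (intro equalityI subsetI)
    fix v assume "v \<in> tangent_ball A g x \<rho>"
    then have "v \<in> TS" "\<iota> x v \<in> ball 0 \<rho>" using nrm by (auto simp: tangent_ball_def TS_def)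
    then show "v \<in> E0 ` ball 0 \<rho>" using E0i[of v] by (metis imageI)
  next
    fix v assume "v \<in> E0 ` ball 0 \<rho>"
    then obtain y where "y \<in> ball 0 \<rho>" "v = E0 y" by blast
    then show "v \<in> tangent_ball A g x \<rho>"
      using E0[of y] nrm[of "E0 y"] by (simp add: tangent_ball_def TS_def)
  qed
  have gb: "geodesic_ball A g x \<rho> = E ` ball 0 \<rho>" for \<rho>
    by (simp add: geodesic_ball_def tb E_def image_comp)
  have \<Omega>: "\<Omega> x = E ` ball 0 (r x)" by (simp add: \<Omega>_def gb)
  from diff have "bij_betw E (ball 0 (r x)) (\<Omega> x)" by (simp add: diffeomorphism_def)
  then have injE: "inj_on E (ball 0 (r x))" by (simp add: bij_betw_def)
  then have inje: "inj_on (exp_map A g x) (tangent_ball A g x (r x))"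
    unfolding tb E_def by (rule inj_on_imageI)
  have \<kappa>E: "\<kappa> x (E y) = y" if "y \<in> ball 0 (r x)" for y
  proof -
    have "E0 y \<in> tangent_ball A g x (r x)" using that by (simp add: tb)
    then have "inv_into (tangent_ball A g x (r x)) (exp_map A g x) (E y) = E0 y"
      unfolding E_def o_def by (rule inv_into_f_f[OF inje])
    then show ?thesis by (simp add: \<kappa>_def normal_coord_def E0)
  qed
  show im: "\<kappa> x ` \<Omega> x = ball 0 (r x)"
    unfolding \<Omega> image_image using \<kappa>E by simp
  have inj\<kappa>: "inj_on (\<kappa> x) (\<Omega> x)"
    unfolding \<Omega> by (rule inj_on_inverseI[of _ E]) (use \<kappa>E in auto)
  have inv\<kappa>: "inv_into (\<Omega> x) (\<kappa> x) y = E y" if "y \<in> ball 0 (r x)" for y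
    using inv_into_f_f[OF inj\<kappa>, of "E y"] \<kappa>E[OF that] that by (simp add: \<Omega>)
  have invE: "inv_into (ball 0 (r x)) E u = \<kappa> x u" if "u \<in> \<Omega> x" for u
    using that \<kappa>E inv_into_f_f[OF injE] by (auto simp: \<Omega>)
  show "geodesic_ball A g x \<rho> = {u \<in> \<Omega> x. \<kappa> x u \<in> ball 0 \<rho>}" if "\<rho> \<le> r x"
    unfolding gb \<Omega> using that \<kappa>E by (auto simp: image_iff)
  have sE: "smooth_map eucl_structure A (ball 0 (r x)) E"
    and s\<kappa>: "smooth_map A eucl_structure (\<Omega> x) (inv_into (ball 0 (r x)) E)"
    and op: "open (\<Omega> x)"
    using diff by (simp_all add: diffeomorphism_def)
  have cE: "continuous_on (ball 0 (r x)) E" using sE by (simp add: smooth_map_def)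
  have "continuous_on (\<Omega> x) (inv_into (ball 0 (r x)) E)" using s\<kappa> by (simp add: smooth_map_def)
  then have c\<kappa>: "continuous_on (\<Omega> x) (\<kappa> x)" by (rule continuous_on_eq) (rule invE)
  have hom: "homeomorphism (\<Omega> x) (ball 0 (r x)) (\<kappa> x) (inv_into (\<Omega> x) (\<kappa> x))"
  proof (rule homeomorphismI[OF c\<kappa>])
    show "continuous_on (ball 0 (r x)) (inv_into (\<Omega> x) (\<kappa> x))"
      using cE by (rule continuous_on_eq) (simp add: inv\<kappa>)
  qed (use im inv\<kappa> \<kappa>E inj\<kappa> in \<open>auto simp: \<Omega>\<close>)
  then have chart: "is_chart (\<Omega> x, \<kappa> x)" using op im by (simp add: is_chart_def)
  have A: "smooth_structure A" using g by (simp add: riemannian_manifold_def)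
  have "smooth_transition (\<Omega> x, \<kappa> x) c \<and> smooth_transition c (\<Omega> x, \<kappa> x)" if c: "c \<in> A" for c
  proof -
    obtain V \<psi> where c_eq: "c = (V, \<psi>)" by (cases c)
    with c have V: "(V, \<psi>) \<in> A" by simp
    note chV = smooth_structureD(1)[OF A V]
    have 1: "Cm_on \<infinity> (id ` (UNIV \<inter> ball 0 (r x) \<inter> E -` V)) (\<psi> \<circ> E \<circ> inv_into UNIV id)"
      using sE[unfolded smooth_map_def, THEN conjunct2, rule_format, OF eucl_structure_id]
      V by blast
    have eq: "\<kappa> x ` (\<Omega> x \<inter> V) = ball 0 (r x) \<inter> E -` V" using \<kappa>E by (force simp: \<Omega>)
    have "Cm_on \<infinity> (\<kappa> x ` (\<Omega> x \<inter> V)) (\<psi> \<circ> E)" using 1 by (simp add: eq inv_id)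
    then have t1: "Cm_on \<infinity> (\<kappa> x ` (\<Omega> x \<inter> V)) (\<psi> \<circ> inv_into (\<Omega> x) (\<kappa> x))"
      by (rule Cm_on_cong[OF open_chart_image[OF chart is_chartD(1)[OF chV]]])
        (simp add: eq inv\<kappa>)
    have 2: "Cm_on \<infinity> (\<psi> ` (V \<inter> \<Omega> x \<inter> inv_into (ball 0 (r x)) E -` UNIV))
        (id \<circ> inv_into (ball 0 (r x)) E \<circ> inv_into V \<psi>)"
      using s\<kappa>[unfolded smooth_map_def, THEN conjunct2] V eucl_structure_id by blast
    then have "Cm_on \<infinity> (\<psi> ` (V \<inter> \<Omega> x)) (inv_into (ball 0 (r x)) E \<circ> inv_into V \<psi>)"
      by simp
    then have t2: "Cm_on \<infinity> (\<psi> ` (V \<inter> \<Omega> x)) (\<kappa> x \<circ> inv_into V \<psi>)"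
      by (rule Cm_on_cong[OF open_chart_image[OF chV op]])
        (use inv_into_image_Int(1)[OF is_chartD(3)[OF chV]] invE in auto)
    show ?thesis using t1 t2 by (simp add: c_eq smooth_transition_def)
  qed
  then show "(\<Omega> x, \<kappa> x) \<in> A"
    using A[unfolded smooth_structure_def, THEN conjunct2, THEN conjunct2, THEN conjunct2,
        THEN spec, of "(\<Omega> x, \<kappa> x)"] chart by simp
qed

section \<open>Transport of \<open>L\<^sup>2\<close> functions\<close>

text \<open>A bijection \<open>\<tau>\<close> with inverse \<open>\<eta>\<close> from a subset \<open>\<Omega>\<close> of a measure space onto a Borel set of
  a Euclidean space, which maps the measure to one with positive density \<open>\<theta>\<close>.\<close>

locale density_coordinates =
  fixes M :: "'a measure" and \<Omega> :: "'a set" and \<tau> :: "'a \<Rightarrow> 'e::euclidean_space"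
    and \<eta> :: "'e \<Rightarrow> 'a" and \<theta> :: "'e \<Rightarrow> real"
  assumes \<Omega>: "\<Omega> \<in> sets M"
    and \<tau>: "\<tau> \<in> borel_measurable (restrict_space M \<Omega>)"
    and \<eta>: "\<eta> \<in> measurable (restrict_space borel (\<tau> ` \<Omega>)) M"
    and B: "\<tau> ` \<Omega> \<in> sets borel"
    and \<eta>\<tau>: "u \<in> \<Omega> \<Longrightarrow> \<eta> (\<tau> u) = u"
    and \<theta>: "\<theta> \<in> borel_measurable borel"
    and \<theta>_pos: "z \<in> \<tau> ` \<Omega> \<Longrightarrow> \<theta> z > 0"
    and \<theta>_zero: "z \<notin> \<tau> ` \<Omega> \<Longrightarrow> \<theta> z = 0"
    and push: "distr (restrict_space M \<Omega>) borel \<tau> = density lborel \<theta>"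
begin

text \<open>The \<open>L\<^sup>2\<close> isometry from functions on \<open>\<Omega>\<close> to functions on \<open>\<tau> ` \<Omega>\<close>, and its inverse, both
  extended by zero.  They are transposes of each other with respect to the bilinear pairing.\<close>

definition pull :: "('a \<Rightarrow> complex) \<Rightarrow> 'e \<Rightarrow> complex" where
  "pull G z = (if z \<in> \<tau> ` \<Omega> then G (\<eta> z) * of_real (sqrt (\<theta> z)) else 0)"

definition push_fun :: "('e \<Rightarrow> complex) \<Rightarrow> 'a \<Rightarrow> complex" where
  "push_fun h u = (if u \<in> \<Omega> then h (\<tau> u) / of_real (sqrt (\<theta> (\<tau> u))) else 0)"

lemma \<theta>_nonneg: "\<theta> z \<ge> 0"
  using \<theta>_pos \<theta>_zero by (metis less_eq_real_def)

lemma space_Int: "\<Omega> \<inter> space M \<in> sets M"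
  using \<Omega> by auto

lemma integral_coordinates:
  fixes h :: "'e \<Rightarrow> 'b::{banach, second_countable_topology}"
  assumes h: "h \<in> borel_measurable borel"
  shows "(\<integral>u. indicator \<Omega> u *\<^sub>R h (\<tau> u) \<partial>M) = (\<integral>z. \<theta> z *\<^sub>R h z \<partial>lborel)"
    and "integrable M (\<lambda>u. indicator \<Omega> u *\<^sub>R h (\<tau> u)) \<longleftrightarrow> integrable lborel (\<lambda>z. \<theta> z *\<^sub>R h z)"
proof -
  have "(\<integral>u. indicator \<Omega> u *\<^sub>R h (\<tau> u) \<partial>M) = (\<integral>u. h (\<tau> u) \<partial>restrict_space M \<Omega>)"
    by (rule integral_restrict_space[OF space_Int, symmetric])
  also have "\<dots> = (\<integral>z. h z \<partial>density lborel \<theta>)"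
    unfolding push[symmetric] by (rule integral_distr[OF \<tau> h, symmetric])
  also have "\<dots> = (\<integral>z. \<theta> z *\<^sub>R h z \<partial>lborel)"
    by (rule integral_density) (use h \<theta> \<theta>_nonneg in auto)
  finally show "(\<integral>u. indicator \<Omega> u *\<^sub>R h (\<tau> u) \<partial>M) = (\<integral>z. \<theta> z *\<^sub>R h z \<partial>lborel)" .
  have "integrable M (\<lambda>u. indicator \<Omega> u *\<^sub>R h (\<tau> u)) \<longleftrightarrow>
      integrable (restrict_space M \<Omega>) (\<lambda>u. h (\<tau> u))"
    by (rule integrable_restrict_space[OF space_Int, symmetric])
  also have "\<dots> \<longleftrightarrow> integrable (density lborel \<theta>) h"
    unfolding push[symmetric] by (rule integrable_distr_eq[OF \<tau> h, symmetric])
  also have "\<dots> \<longleftrightarrow> integrable lborel (\<lambda>z. \<theta> z *\<^sub>R h z)"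
    by (rule integrable_density) (use h \<theta> \<theta>_nonneg in auto)
  finally show "integrable M (\<lambda>u. indicator \<Omega> u *\<^sub>R h (\<tau> u)) \<longleftrightarrow>
    integrable lborel (\<lambda>z. \<theta> z *\<^sub>R h z)" .
qed

lemma measurable_\<eta>_if:
  fixes G :: "'a \<Rightarrow> complex"
  assumes "G \<in> borel_measurable M"
  shows "(\<lambda>z. if z \<in> \<tau> ` \<Omega> then G (\<eta> z) else 0) \<in> borel_measurable borel"
  by (rule measurable_If_restrict_space_iff[THEN iffD2])
    (use B measurable_compose[OF \<eta> assms] in auto)

lemma measurable_pull:
  assumes "G \<in> borel_measurable M" shows "pull G \<in> borel_measurable borel"
proof -
  have "(\<lambda>z. (if z \<in> \<tau> ` \<Omega> then G (\<eta> z) else 0) * of_real (sqrt (\<theta> z)))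
      \<in> borel_measurable borel"
    using measurable_\<eta>_if[OF assms] \<theta> by measurable
  then show ?thesis by (simp add: pull_def[abs_def] if_distrib[of "\<lambda>c. c * _"] cong: if_cong)
qed

lemma measurable_push_fun:
  assumes "h \<in> borel_measurable borel" shows "push_fun h \<in> borel_measurable M"
proof -
  have "(\<lambda>z. h z / of_real (sqrt (\<theta> z))) \<in> borel_measurable borel"
    using assms \<theta> by measurable
  then have "(\<lambda>u. h (\<tau> u) / of_real (sqrt (\<theta> (\<tau> u)))) \<in> borel_measurable (restrict_space M \<Omega>)"
    by (rule measurable_compose[OF \<tau>])
  then show ?thesis
    unfolding push_fun_def[abs_def]
    by (intro measurable_If_restrict_space_iff[THEN iffD2]) (use \<Omega> in auto)
qed

lemma L2_push_fun:
  assumes h: "h \<in> borel_measurable borel"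
    and int: "integrable lborel (\<lambda>z. indicator (\<tau> ` \<Omega>) z *\<^sub>R (cmod (h z))\<^sup>2)"
  shows "L2_fun M (push_fun h)"
proof -
  let ?h = "\<lambda>z. (cmod (h z))\<^sup>2 / \<theta> z"
  have "(\<lambda>z. indicator (\<tau> ` \<Omega>) z *\<^sub>R (cmod (h z))\<^sup>2) = (\<lambda>z. \<theta> z *\<^sub>R ?h z)"
    using \<theta>_zero less_imp_neq[OF \<theta>_pos, symmetric] by (auto simp: fun_eq_iff indicator_def)
  with int have "integrable lborel (\<lambda>z. \<theta> z *\<^sub>R ?h z)" by simp
  moreover have "?h \<in> borel_measurable borel" using h \<theta> by measurable
  ultimately have "integrable M (\<lambda>u. indicator \<Omega> u *\<^sub>R ?h (\<tau> u))"
    using integral_coordinates(2) by blast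
  moreover have "(\<lambda>u. indicator \<Omega> u *\<^sub>R ?h (\<tau> u)) = (\<lambda>u. (cmod (push_fun h u))\<^sup>2)"
    using \<theta>_nonneg
    by (auto simp: fun_eq_iff push_fun_def indicator_def norm_divide power_divide)
  ultimately show ?thesis
    unfolding L2_fun_def using measurable_push_fun[OF h] by simp
qed

lemma pairing_push_fun:
  assumes h: "h \<in> borel_measurable borel" and G: "G \<in> borel_measurable M"
  shows "pairing M G (push_fun h) = pairing lborel (pull G) h"
proof -
  let ?h = "\<lambda>z. (if z \<in> \<tau> ` \<Omega> then G (\<eta> z) else 0) * (h z / of_real (sqrt (\<theta> z)))"
  have m: "?h \<in> borel_measurable borel"
    using measurable_\<eta>_if[OF G] h \<theta> by measurable
  have sq: "of_real (\<theta> z) = (of_real (sqrt (\<theta> z)) * of_real (sqrt (\<theta> z)) :: complex)" for z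
    using \<theta>_nonneg[of z] by (simp flip: of_real_mult)
  have "pairing M G (push_fun h) = (\<integral>u. indicator \<Omega> u *\<^sub>R ?h (\<tau> u) \<partial>M)"
    unfolding pairing_def push_fun_def
    by (intro Bochner_Integration.integral_cong) (auto simp: indicator_def \<eta>\<tau>)
  also have "\<dots> = (\<integral>z. \<theta> z *\<^sub>R ?h z \<partial>lborel)" by (rule integral_coordinates(1)[OF m])
  also have "\<dots> = pairing lborel (pull G) h"
    unfolding pairing_def pull_def
  proof (intro Bochner_Integration.integral_cong refl)
    fix z
    show "\<theta> z *\<^sub>R ?h z = (if z \<in> \<tau> ` \<Omega> then G (\<eta> z) * of_real (sqrt (\<theta> z)) else 0) * h z"
    proof (cases "z \<in> \<tau> ` \<Omega>")
      case True
      then have "(of_real (sqrt (\<theta> z)) :: complex) \<noteq> 0" using \<theta>_pos[of z] by simp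
      then show ?thesis using True by (simp add: scaleR_conv_of_real sq[of z])
    qed simp
  qed
  finally show ?thesis .
qed

lemma L2_pull:
  assumes G: "L2_fun M G" and supp: "\<And>u. u \<notin> \<Omega> \<Longrightarrow> G u = 0"
  shows "L2_fun lborel (pull G)" "L2_nrm lborel (pull G) = L2_nrm M G"
proof -
  have Gm: "G \<in> borel_measurable M" using G by (simp add: L2_fun_def)
  let ?h = "\<lambda>z. (cmod (if z \<in> \<tau> ` \<Omega> then G (\<eta> z) else 0))\<^sup>2"
  have m: "?h \<in> borel_measurable borel"
    using measurable_\<eta>_if[OF Gm] by measurable
  have 1: "(\<lambda>u. indicator \<Omega> u *\<^sub>R ?h (\<tau> u)) = (\<lambda>u. (cmod (G u))\<^sup>2)"
    using supp by (auto simp: fun_eq_iff indicator_def \<eta>\<tau>)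
  have 2: "(\<lambda>z. \<theta> z *\<^sub>R ?h z) = (\<lambda>z. (cmod (pull G z))\<^sup>2)"
    using \<theta>_nonneg
    by (auto simp: fun_eq_iff pull_def norm_mult power_mult_distrib)
  show "L2_fun lborel (pull G)"
    using G integral_coordinates(2)[OF m] measurable_pull[OF Gm]
    unfolding L2_fun_def 1 2 by simp
  show "L2_nrm lborel (pull G) = L2_nrm M G"
    using integral_coordinates(1)[OF m] unfolding L2_nrm_def 1 2 by simp
qed

end

section \<open>The localization operators\<close>

lemma nn_integral_lborel_scale:
  fixes F :: "'e::euclidean_space \<Rightarrow> ennreal"
  assumes F: "F \<in> borel_measurable borel" and s: "s > 0"
  shows "(\<integral>\<^sup>+ y. F (s *\<^sub>R y) \<partial>lborel) = (\<integral>\<^sup>+ z. ennreal (1 / s ^ DIM('e)) * F z \<partial>lborel)"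
proof -
  have "(\<integral>\<^sup>+ z. F z \<partial>lborel) = ennreal (s ^ DIM('e)) * (\<integral>\<^sup>+ y. F (s *\<^sub>R y) \<partial>lborel)"
    using F s
    by (subst lborel_affine[of s 0]) (auto simp: nn_integral_density nn_integral_distr nn_integral_cmult)
  then have "ennreal (1 / s ^ DIM('e)) * (\<integral>\<^sup>+ z. F z \<partial>lborel) =
      ennreal (1 / s ^ DIM('e) * s ^ DIM('e)) * (\<integral>\<^sup>+ y. F (s *\<^sub>R y) \<partial>lborel)"
    using s by (subst ennreal_mult) (auto simp: mult.assoc)
  then show ?thesis using s F by (simp add: nn_integral_cmult)
qed


lemma Cm_on_det_metric:
  fixes A :: "('a::topological_space, real^'d) chart set"
  assumes g: "riemannian_manifold A g" and c: "(U, \<phi>) \<in> A"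
  shows "Cm_on m (\<phi> ` U) (\<lambda>y. det (metric_matrix A g (U, \<phi>) (inv_into U \<phi> y)))"
proof -
  have A: "smooth_structure A" using g by (simp add: riemannian_manifold_def)
  note op = is_chartD(2)[OF smooth_structureD(1)[OF A c]]
  note entries = g[unfolded riemannian_manifold_def, THEN conjunct2, THEN conjunct2, THEN bspec,
      OF c, unfolded prod.case, THEN spec, THEN spec, THEN Cm_on_le, of m]
  show ?thesis
    unfolding det_def
    by (intro Cm_on_sum[OF op] Cm_on_mult[OF op] Cm_on_prod[OF op] Cm_on_const entries) simp
qed

text \<open>\<open>scal x\<close> is the factor \<open>3 \<surd>d / r(x)\<close> in the definition of \<open>T\<^sup>2\<^sub>x\<close>.  It is a parameter because the
  dimension \<open>d\<close> would occur only as a type in a definition of it.\<close>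

locale normal_coordinates =
  fixes A :: "('a::{t2_space, second_countable_topology}, real^'d) chart set"
    and g :: "'a metric" and \<nu> :: "'a measure" and r :: "'a \<Rightarrow> real"
    and \<iota> :: "'a \<Rightarrow> 'a tvec \<Rightarrow> real^'d" and scal :: "'a \<Rightarrow> real"
  assumes g: "riemannian_manifold A g" and \<nu>: "riemannian_measure A g \<nu>"
    and radii: "normal_radii A g r \<iota>" and scal: "scal x = 3 * sqrt (real CARD('d)) / r x"
begin

abbreviation ball_at :: "'a \<Rightarrow> 'a set" where "ball_at x \<equiv> geodesic_ball A g x (r x)"
abbreviation \<kappa> :: "'a \<Rightarrow> 'a \<Rightarrow> real^'d" where "\<kappa> x \<equiv> normal_coord A g r \<iota> x"

text \<open>Rescaled normal coordinates \<open>z = (3 \<surd>d / r) \<kappa>(u)\<close>, their inverse, and the density of the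
  Riemannian measure in these coordinates.\<close>

definition zcoord :: "'a \<Rightarrow> 'a \<Rightarrow> real^'d" where
  "zcoord x u = scal x *\<^sub>R \<kappa> x u"

definition zinv :: "'a \<Rightarrow> real^'d \<Rightarrow> 'a" where
  "zinv x z = inv_into (ball_at x) (\<kappa> x) ((1 / scal x) *\<^sub>R z)"

definition zdensity :: "'a \<Rightarrow> real^'d \<Rightarrow> real" where
  "zdensity x z = (if z \<in> ball 0 (scal x * r x)
     then sqrt \<bar>det (metric_matrix A g (ball_at x, \<kappa> x) (zinv x z))\<bar> / scal x ^ CARD('d) else 0)"

lemma smooth: "smooth_structure A"
  using g by (simp add: riemannian_manifold_def)

lemma sets_\<nu>: "sets \<nu> = sets borel"
  using \<nu> by (simp add: riemannian_measure_def)

lemma r_pos: "r x > 0"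
  using radii by (simp add: normal_radii_def)

lemma scal_pos: "scal x > 0"
  using r_pos by (simp add: scal)

lemmas chart = normal_chart(1)[OF g radii]
lemmas \<kappa>_image = normal_chart(2)[OF g radii]
lemmas chartD = is_chartD[OF smooth_structureD(1)[OF smooth chart]]

lemma zcoord_image: "zcoord x ` ball_at x = ball 0 (scal x * r x)"
proof -
  have "zcoord x ` ball_at x = (\<lambda>y. scal x *\<^sub>R y) ` (\<kappa> x ` ball_at x)"
    by (simp add: zcoord_def[abs_def] image_image)
  also have "\<dots> = (\<lambda>y. scal x *\<^sub>R y) ` ball 0 (r x)" by (simp add: \<kappa>_image)
  also have "\<dots> = ball 0 (scal x * r x)"
    using ball_scale[of "scal x" "0::real^'d" "r x"] scal_pos[of x] by simp
  finally show ?thesis .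
qed

lemma zinv_zcoord: "u \<in> ball_at x \<Longrightarrow> zinv x (zcoord x u) = u"
  using scal_pos[of x] by (simp add: zinv_def zcoord_def inv_into_f_f[OF chartD(3)])

lemma continuous_on_zcoord: "continuous_on (ball_at x) (zcoord x)"
  unfolding zcoord_def[abs_def] by (intro continuous_intros chartD(4))

lemma scaled_in_ball: "z \<in> ball 0 (scal x * r x) \<longleftrightarrow> (1 / scal x) *\<^sub>R z \<in> ball 0 (r x)"
  for z :: "real^'d"
  using scal_pos[of x] r_pos[of x] by (simp add: field_simps)

lemma continuous_on_zinv: "continuous_on (ball 0 (scal x * r x)) (zinv x)"
  unfolding zinv_def[abs_def]
  by (rule continuous_on_compose2[OF chartD(5)])
    (use scaled_in_ball in \<open>auto intro!: continuous_intros simp: \<kappa>_image\<close>)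

lemma det_nonzero: "u \<in> ball_at x \<Longrightarrow> det (metric_matrix A g (ball_at x, \<kappa> x) u) \<noteq> 0"
  by (rule det_metric_matrix_nonzero[OF g chart])

lemma zinv_in: "z \<in> ball 0 (scal x * r x) \<Longrightarrow> zinv x z \<in> ball_at x"
  using inv_into_into[of "(1 / scal x) *\<^sub>R z" "\<kappa> x" "ball_at x"] scaled_in_ball[of z x]
  by (simp add: zinv_def \<kappa>_image)

lemma Cm_on_det: "Cm_on m (ball 0 (scal x * r x))
    (\<lambda>z. det (metric_matrix A g (ball_at x, \<kappa> x) (zinv x z)))"
  unfolding zinv_def
  by (rule Cm_on_compose[OF open_ball open_ball Cm_on_det_metric[OF g chart, unfolded \<kappa>_image]])
    (use scaled_in_ball in \<open>auto intro!: Cm_on_bounded_linear bounded_linear_scaleR_right\<close>)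

lemma zdensity_measurable: "zdensity x \<in> borel_measurable borel"
proof -
  have "continuous_on (ball 0 (scal x * r x)) (\<lambda>z. sqrt
      \<bar>det (metric_matrix A g (ball_at x, \<kappa> x) (zinv x z))\<bar> / scal x ^ CARD('d))"
    using scal_pos[of x] by (intro continuous_intros Cm_on_continuous[OF Cm_on_det]) auto
  then show ?thesis
    unfolding zdensity_def[abs_def]
    by (intro measurable_If_restrict_space_iff[THEN iffD2] conjI
        borel_measurable_continuous_on_restrict) (simp_all del: mem_ball mem_ball_0)
qed

lemma measurable_zcoord: "zcoord x \<in> borel_measurable (restrict_space \<nu> (ball_at x))"
  using borel_measurable_continuous_on_restrict[OF continuous_on_zcoord]
      measurable_cong_sets[OF sets_restrict_space_cong[OF sets_\<nu>] refl] by blast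

lemma zdensity_nonneg: "zdensity x z \<ge> 0"
  using scal_pos[of x] by (simp add: zdensity_def)

lemma distr_zcoord:
  "distr (restrict_space \<nu> (ball_at x)) borel (zcoord x) = density lborel (zdensity x)"
proof (rule measure_eqI)
  fix C assume "C \<in> sets (distr (restrict_space \<nu> (ball_at x)) borel (zcoord x))"
  then have C: "C \<in> sets borel" by simp
  let ?S = "zcoord x -` C \<inter> ball_at x"
  let ?D = "\<lambda>y. ennreal (sqrt \<bar>det (metric_matrix A g (ball_at x, \<kappa> x)
    (inv_into (ball_at x) (\<kappa> x) y))\<bar>)"
  \<comment> \<open>On \<open>C\<close>, \<open>?F\<close> is the density in the unscaled chart as a function of the scaled variable; the
    two densities differ by the Jacobian of the scaling.\<close>
  let ?F = "\<lambda>z. ennreal (zdensity x z * scal x ^ CARD('d)) * indicator C z"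
  note \<tau> = measurable_zcoord[of x]
  have sp: "space \<nu> = UNIV" using sets_eq_imp_space_eq[OF sets_\<nu>] by simp
  have S: "?S \<in> sets borel"
    using measurable_sets[OF \<tau> C] chartD(1)[of x] sets_\<nu>
    by (simp add: space_restrict_space sp sets_restrict_space_iff)
  have "emeasure (distr (restrict_space \<nu> (ball_at x)) borel (zcoord x)) C = emeasure \<nu> ?S"
    using C \<tau> chartD(1)[of x] sets_\<nu>
    by (simp add: emeasure_distr emeasure_restrict_space space_restrict_space sp)
  also have "\<dots> = (\<integral>\<^sup>+ y\<in>\<kappa> x ` ?S. ?D y \<partial>lborel)"
    using \<nu>[unfolded riemannian_measure_def, THEN conjunct2, THEN bspec, OF chart[of x]] S by simp
  also have "\<dots> = (\<integral>\<^sup>+ y. ?F (scal x *\<^sub>R y) \<partial>lborel)"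
  proof (intro nn_integral_cong)
    fix y :: "real^'d"
    have "y \<in> \<kappa> x ` ?S \<longleftrightarrow> y \<in> ball 0 (r x) \<and> scal x *\<^sub>R y \<in> C"
      unfolding \<kappa>_image[symmetric] zcoord_def[abs_def] by auto
    moreover have "scal x *\<^sub>R y \<in> ball 0 (scal x * r x) \<longleftrightarrow> y \<in> ball 0 (r x)"
      using scaled_in_ball[of "scal x *\<^sub>R y" x] scal_pos[of x] by simp
    ultimately show "?D y * indicator (\<kappa> x ` ?S) y = ?F (scal x *\<^sub>R y)"
      using scal_pos[of x] by (simp add: zdensity_def zinv_def indicator_def)
  qed
  also have "\<dots> = (\<integral>\<^sup>+ z. ennreal (1 / scal x ^ DIM(real^'d)) * ?F z \<partial>lborel)"
    by (rule nn_integral_lborel_scale) (use C zdensity_measurable scal_pos in auto)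
  also have "\<dots> = (\<integral>\<^sup>+ z. ennreal (zdensity x z) * indicator C z \<partial>lborel)"
    using scal_pos[of x]
    by (intro nn_integral_cong)
      (simp add: indicator_def zdensity_nonneg flip: ennreal_mult)
  also have "\<dots> = emeasure (density lborel (zdensity x)) C"
    using C zdensity_measurable by (subst emeasure_density) auto
  finally show "emeasure (distr (restrict_space \<nu> (ball_at x)) borel (zcoord x)) C =
    emeasure (density lborel (zdensity x)) C" .
qed simp

sublocale density_coordinates \<nu> "ball_at x" "zcoord x" "zinv x" "zdensity x" for x
proof
  show "ball_at x \<in> sets \<nu>" using chartD(1) sets_\<nu> by simp
  show "zcoord x \<in> borel_measurable (restrict_space \<nu> (ball_at x))"
    by (rule measurable_zcoord)
  show "zinv x \<in> measurable (restrict_space borel (zcoord x ` ball_at x)) \<nu>"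
    using borel_measurable_continuous_on_restrict[OF continuous_on_zinv]
      measurable_cong_sets[OF refl sets_\<nu>] zcoord_image by metis
  show "zcoord x ` ball_at x \<in> sets borel" by (simp add: zcoord_image)
  show "zdensity x z > 0" if "z \<in> zcoord x ` ball_at x" for z
    using that det_nonzero[OF zinv_in] scal_pos[of x] by (simp add: zdensity_def zcoord_image)
qed (simp_all add: zinv_zcoord zdensity_measurable distr_zcoord zdensity_def zcoord_image)

lemma T2_eq_push_fun: "T2 A g r \<iota> x f = push_fun x f"
proof
  fix u
  show "T2 A g r \<iota> x f u = push_fun x f u"
  proof (cases "u \<in> ball_at x")
    case u: True
    let ?D = "\<bar>det (metric_matrix A g (ball_at x, \<kappa> x) u)\<bar>" and ?d = "real CARD('d)"
    have D: "?D > 0" using det_nonzero[OF u] by simp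
    have z: "zcoord x u \<in> ball 0 (scal x * r x)" using u zcoord_image by blast
    define c where "c = scal x"
    have c: "c > 0" using scal_pos by (simp add: c_def)
    have "zdensity x (zcoord x u) = sqrt ?D / c ^ CARD('d)"
      using z unfolding zdensity_def zinv_zcoord[OF u] c_def by (rule if_P)
    also have "\<dots> = ?D powr (1 / 2) / c powr ?d"
      using c by (simp add: powr_half_sqrt powr_realpow)
    finally have "sqrt (zdensity x (zcoord x u)) = sqrt (?D powr (1 / 2)) / sqrt (c powr ?d)"
      by (simp only: real_sqrt_divide)
    also have "\<dots> = ?D powr (1 / 4) / c powr (?d / 2)"
      by (simp add: powr_half_sqrt[symmetric] powr_powr)
    finally have "inverse (sqrt (zdensity x (zcoord x u))) = c powr (?d / 2) * inverse (?D powr (1 / 4))"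
      by (simp only: inverse_divide divide_inverse[of "c powr (?d / 2)"])
    also have "inverse (?D powr (1 / 4)) = ?D powr (- 1 / 4)"
      using powr_minus[of ?D "1 / 4"] by simp
    finally have eq: "inverse (sqrt (zdensity x (zcoord x u))) =
        c powr (?d / 2) * ?D powr (- 1 / 4)" .
    then show ?thesis
      using u unfolding T2_def scal[symmetric] push_fun_def Let_def divide_inverse[of "f _"]
        of_real_inverse[symmetric] eq
      by (simp add: zcoord_def c_def)
  qed (simp add: T2_def scal[symmetric] push_fun_def Let_def)
qed

text \<open>Smoothness inside \<open>\<Omega>\<^sub>x(r(x))\<close> suffices, since operators localized on \<open>\<Omega>\<^sub>x\<close> depend on the values
  in \<open>\<Omega>\<^sub>x\<close> only.\<close>

lemma Cm_T2:
  assumes f: "Cm_on m UNIV f"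
  shows "Cm_fun_on A m (ball_at x) (T2 A g r \<iota> x f)"
proof -
  let ?B = "ball 0 (scal x * r x) :: (real^'d) set"
  let ?D = "\<lambda>z. det (metric_matrix A g (ball_at x, \<kappa> x) (zinv x z))"
  have "?D z * ?D z > 0" if "z \<in> ?B" for z
    using det_nonzero[OF zinv_in[OF that]] not_real_square_gt_zero[of "?D z"] by blast
  \<comment> \<open>Writing \<open>\<bar>D\<bar>\<close> as a power of \<open>D\<^sup>2\<close> avoids the absolute value, which is not smooth.\<close>
  then have "Cm_on m ?B (\<lambda>z. (?D z * ?D z) powr (- 1 / 8))"
    by (intro Cm_on_compose[OF open_ball open_greaterThan Cm_on_powr Cm_on_mult[OF open_ball Cm_on_det Cm_on_det]])
      auto
  then have "Cm_on m ?B (\<lambda>z. \<bar>?D z\<bar> powr (- 1 / 4))"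
  proof (rule Cm_on_cong[OF open_ball])
    fix z
    have "(?D z * ?D z) = \<bar>?D z\<bar> powr 2" by (simp add: power2_eq_square)
    then have "(?D z * ?D z) powr (- 1 / 8) = (\<bar>?D z\<bar> powr 2) powr (- 1 / 8)" by (rule arg_cong)
    also have "\<dots> = \<bar>?D z\<bar> powr (- 1 / 4)" unfolding powr_powr by simp
    finally show "(?D z * ?D z) powr (- 1 / 8) = \<bar>?D z\<bar> powr (- 1 / 4)" .
  qed
  then have "Cm_on m ?B (\<lambda>z. (of_real (scal x powr (real CARD('d) / 2)) * f z) *
      of_real (\<bar>?D z\<bar> powr (- 1 / 4)))"
    by (intro Cm_on_mult Cm_on_const Cm_on_subset[OF f]
        Cm_on_bounded_linear_comp[OF bounded_linear_of_real] open_ball) auto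
  moreover have "(\<lambda>y. scal x *\<^sub>R y) ` ball 0 (r x) \<subseteq> ?B"
    using scaled_in_ball[of "scal x *\<^sub>R _" x] scal_pos[of x] by auto
  ultimately have "Cm_on m (ball 0 (r x)) (\<lambda>y. (of_real (scal x powr (real CARD('d) / 2)) *
      f (scal x *\<^sub>R y)) * of_real (\<bar>?D (scal x *\<^sub>R y)\<bar> powr (- 1 / 4)))"
    by (rule Cm_on_compose[OF open_ball open_ball _
          Cm_on_bounded_linear[OF bounded_linear_scaleR_right]])
  then have "Cm_fun_on A m (ball_at x) (\<lambda>u. (of_real (scal x powr (real CARD('d) / 2)) *
      f (scal x *\<^sub>R \<kappa> x u)) * of_real (\<bar>?D (scal x *\<^sub>R \<kappa> x u)\<bar> powr (- 1 / 4)))"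
    by (rule Cm_fun_on_chart[OF smooth chart chartD(1) subset_refl _ open_ball])
      (simp add: \<kappa>_image)
  then show ?thesis
    by (rule Cm_fun_on_cong[OF smooth chartD(1)])
      (simp add: T2_def scal[symmetric] Let_def zinv_zcoord[unfolded zcoord_def])
qed

end

section \<open>Operators localized on a chart\<close>

lemma simple_H_op_outside:
  "u \<notin> fun_support \<phi> \<Longrightarrow> simple_H_op \<phi> \<Phi> V f u = 0"
  using closure_subset[of "{u. \<phi> u \<noteq> 0}"] by (auto simp: simple_H_op_def fun_support_def)

lemma H_localized_compact_support:
  assumes "H_localized A U T"
  obtains K where "compact K" "K \<subseteq> U" "\<forall>f. \<forall>u\<in>- K. T f u = 0"
proof -
  obtain n :: nat and c \<phi> \<Phi> V where
    d: "\<forall>i<n. simple_H_data A (\<phi> i) (\<Phi> i) (V i) \<and> V i \<subseteq> U \<and> \<Phi> i ` V i \<subseteq> U"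
    and T: "\<forall>f x. T f x = (\<Sum>i<n. c i * simple_H_op (\<phi> i) (\<Phi> i) (V i) f x)"
    using assms unfolding H_localized_def by (elim exE conjE) (rule that)
  let ?K = "\<Union>i<n. fun_support (\<phi> i)"
  show ?thesis
  proof
    show "compact ?K" using d by (intro compact_UN) (auto simp: simple_H_data_def)
    show "?K \<subseteq> U"
    proof (rule UN_least)
      fix i assume "i \<in> {..<n}"
      then have "fun_support (\<phi> i) \<subseteq> V i" "V i \<subseteq> U"
        using d by (simp_all add: simple_H_data_def)
      then show "fun_support (\<phi> i) \<subseteq> U" by (rule order_trans)
    qed
    show "\<forall>f. \<forall>u\<in>- ?K. T f u = 0"
      by (simp add: T simple_H_op_outside)
  qed
qed

text \<open>Where \<open>\<Phi>\<close> maps \<open>V\<close> into the domain of one chart, \<open>f \<circ> \<Phi>\<close> is handled in this chart; outside of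
  the support of \<open>\<phi>\<close> the result vanishes.\<close>

lemma Cm_simple_H_op:
  fixes A :: "('a::t2_space, real^'d) chart set"
  assumes A: "smooth_structure A" and c: "(W, \<psi>) \<in> A" and f: "Cm_fun_on A m W f"
    and H: "simple_H_data A \<phi> \<Phi> V" and im: "\<Phi> ` V \<subseteq> W"
  shows "Cm_fun A m (simple_H_op \<phi> \<Phi> V f)"
proof -
  obtain V' where diff: "diffeomorphism A A V V' \<Phi>" and \<phi>: "Cm_fun A \<infinity> \<phi>"
    and K: "compact (fun_support \<phi>)" "fun_support \<phi> \<subseteq> V"
    using H unfolding simple_H_data_def by blast
  have V: "open V" and s: "smooth_map A A V \<Phi>" using diff by (simp_all add: diffeomorphism_def)
  note chW = smooth_structureD(1)[OF A c]
  have f': "Cm_on m (\<psi> ` W) (f \<circ> inv_into W \<psi>)" using f c by (auto simp: Cm_fun_on_def)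
  have f\<Phi>: "Cm_fun_on A m V (\<lambda>u. f (\<Phi> u))"
    unfolding Cm_fun_on_def
  proof safe
    fix U \<phi>' assume U: "(U, \<phi>') \<in> A"
    note ch = smooth_structureD(1)[OF A U]
    note inv = inv_into_image_Int[OF is_chartD(3)[OF ch], of _ V]
    have "Cm_on \<infinity> (\<phi>' ` (U \<inter> V \<inter> \<Phi> -` W)) (\<psi> \<circ> \<Phi> \<circ> inv_into U \<phi>')"
      using s[unfolded smooth_map_def, THEN conjunct2] U c by blast
    moreover have "U \<inter> V \<inter> \<Phi> -` W = U \<inter> V" using im by auto
    ultimately have "Cm_on m (\<phi>' ` (U \<inter> V)) (\<psi> \<circ> \<Phi> \<circ> inv_into U \<phi>')"
      using Cm_on_le by fastforce
    then have "Cm_on m (\<phi>' ` (U \<inter> V))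
        (\<lambda>y. (f \<circ> inv_into W \<psi>) ((\<psi> \<circ> \<Phi> \<circ> inv_into U \<phi>') y))"
    proof (rule Cm_on_compose[OF open_chart_image[OF ch V] is_chartD(2)[OF chW] f'])
      show "(\<psi> \<circ> \<Phi> \<circ> inv_into U \<phi>') ` \<phi>' ` (U \<inter> V) \<subseteq> \<psi> ` W"
      proof (rule image_subsetI)
        fix y assume "y \<in> \<phi>' ` (U \<inter> V)"
        then have "\<Phi> (inv_into U \<phi>' y) \<in> W" using inv(1) im by blast
        then show "(\<psi> \<circ> \<Phi> \<circ> inv_into U \<phi>') y \<in> \<psi> ` W" by simp
      qed
    qed
    then show "Cm_on m (\<phi>' ` (U \<inter> V)) ((\<lambda>u. f (\<Phi> u)) \<circ> inv_into U \<phi>')"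
    proof (rule Cm_on_cong[OF open_chart_image[OF ch V]])
      fix y assume "y \<in> \<phi>' ` (U \<inter> V)"
      then have "\<Phi> (inv_into U \<phi>' y) \<in> W" using inv(1) im by blast
      then show "(f \<circ> inv_into W \<psi>) ((\<psi> \<circ> \<Phi> \<circ> inv_into U \<phi>') y) =
          ((\<lambda>u. f (\<Phi> u)) \<circ> inv_into U \<phi>') y"
        using inv_into_f_f[OF is_chartD(3)[OF chW]] by simp
    qed
  qed
  have "Cm_fun_on A m V (\<lambda>u. \<phi> u *\<^sub>R f (\<Phi> u))"
  proof (rule Cm_fun_on_bilinear[OF A V bounded_bilinear_scaleR _ f\<Phi>])
    show "Cm_fun_on A m V \<phi>"
      unfolding Cm_fun_on_def
    proof safe
      fix U \<phi>' assume "(U, \<phi>') \<in> A"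
      with \<phi> have "Cm_on \<infinity> (\<phi>' ` U) (\<phi> \<circ> inv_into U \<phi>')" by (auto simp: Cm_fun_def)
      then have "Cm_on m (\<phi>' ` U) (\<phi> \<circ> inv_into U \<phi>')" by (rule Cm_on_le) simp
      then show "Cm_on m (\<phi>' ` (U \<inter> V)) (\<phi> \<circ> inv_into U \<phi>')" by (rule Cm_on_subset) auto
    qed
  qed
  then have "Cm_fun_on A m V (simple_H_op \<phi> \<Phi> V f)"
    by (rule Cm_fun_on_cong[OF A V]) (simp add: simple_H_op_def scaleR_conv_of_real)
  then show ?thesis
    by (rule Cm_fun_extend_by_zero[OF A V _ compact_imp_closed[OF K(1)] K(2)])
      (rule simple_H_op_outside)
qed

lemma Cm_H_localized:
  fixes A :: "('a::t2_space, real^'d) chart set"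
  assumes A: "smooth_structure A" and c: "(W, \<psi>) \<in> A" and f: "Cm_fun_on A m W f"
    and T: "H_localized A U T" and U: "U \<subseteq> W"
  shows "Cm_fun A m (T f)"
proof -
  obtain n :: nat and c \<phi> \<Phi> V where
    d: "\<forall>i<n. simple_H_data A (\<phi> i) (\<Phi> i) (V i) \<and> V i \<subseteq> U \<and> \<Phi> i ` V i \<subseteq> U"
    and Tf: "\<forall>f x. T f x = (\<Sum>i<n. c i * simple_H_op (\<phi> i) (\<Phi> i) (V i) f x)"
    using T unfolding H_localized_def by (elim exE conjE) (rule that)
  have "Cm_fun_on A m UNIV (\<lambda>u. \<Sum>i<n. c i * simple_H_op (\<phi> i) (\<Phi> i) (V i) f u)"
  proof (intro Cm_fun_on_sum[OF A open_UNIV] Cm_fun_on_bilinear[OF A open_UNIV bounded_bilinear_mult]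
      Cm_fun_on_const)
    fix i assume "i \<in> {..<n}"
    then have i: "simple_H_data A (\<phi> i) (\<Phi> i) (V i)" "\<Phi> i ` V i \<subseteq> W" using d U by auto
    then show "Cm_fun_on A m UNIV (simple_H_op (\<phi> i) (\<Phi> i) (V i) f)"
      unfolding Cm_fun_on_UNIV by (rule Cm_simple_H_op[OF A assms(2) f])
  qed
  moreover have "T f = (\<lambda>u. \<Sum>i<n. c i * simple_H_op (\<phi> i) (\<Phi> i) (V i) f u)"
    using Tf by (simp add: fun_eq_iff)
  ultimately show ?thesis by (simp add: Cm_fun_on_UNIV)
qed

section \<open>The Parseval identity\<close>

lemma L2_fun_cnj: "L2_fun M f \<Longrightarrow> L2_fun M (\<lambda>u. cnj (f u))"
  unfolding L2_fun_def
  by (auto intro: measurable_compose[OF _ borel_measurable_continuous_onI[OF continuous_on_cnj[OF continuous_on_id]]])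

lemma L2_nrm_cnj: "L2_nrm M (\<lambda>u. cnj (f u)) = L2_nrm M f"
  by (simp add: L2_nrm_def)

text \<open>The pairing is bilinear and a projection need not commute with complex conjugation, so its
  transpose is \<open>f \<mapsto> cnj (P (cnj f))\<close>.\<close>

lemma pairing_L2_projection:
  assumes P: "L2_projection M P" and f: "L2_fun M f" and h: "L2_fun M h"
  shows "pairing M f (P h) = pairing M (\<lambda>u. cnj (P (\<lambda>v. cnj (f v)) u)) h"
proof -
  have "(\<integral>u. P h u * cnj (cnj (f u)) \<partial>M) = (\<integral>u. h u * cnj (P (\<lambda>v. cnj (f v)) u) \<partial>M)"
    using P[unfolded L2_projection_def, THEN conjunct2] h L2_fun_cnj[OF f] by blast
  then show ?thesis by (simp add: pairing_def mult.commute)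
qed

lemma local_parseval_frameD:
  assumes "local_parseval_frame m j0 \<epsilon> lam \<Gamma> w"
  shows "i \<in> frame_index j0 \<Gamma> \<Longrightarrow> Cm_on m UNIV (w i)"
    and "L2_fun lborel f \<Longrightarrow> ess_support f \<subseteq> open_cube 1 \<Longrightarrow>
      ((\<lambda>i. (cmod (pairing lborel f (w i)))\<^sup>2) has_sum (L2_nrm lborel f)\<^sup>2) (frame_index j0 \<Gamma>)"
proof -
  note w = assms[unfolded local_parseval_frame_def, THEN conjunct2, THEN conjunct2, THEN conjunct2,
      THEN conjunct2, THEN conjunct2]
  show "i \<in> frame_index j0 \<Gamma> \<Longrightarrow> Cm_on m UNIV (w i)"
    using w[THEN conjunct1] by blast
  show "L2_fun lborel f \<Longrightarrow> ess_support f \<subseteq> open_cube 1 \<Longrightarrow>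
      ((\<lambda>i. (cmod (pairing lborel f (w i)))\<^sup>2) has_sum (L2_nrm lborel f)\<^sup>2) (frame_index j0 \<Gamma>)"
    using w[THEN conjunct2, THEN conjunct1] by blast
qed

context normal_coordinates
begin

lemma Omega_eq: "Omega A g r x = {u \<in> ball_at x. \<kappa> x u \<in> ball 0 (r x / (3 * sqrt (real CARD('d))))}"
proof -
  have "1 \<le> 3 * sqrt (real CARD('d))"
  proof -
    have "1 \<le> sqrt (real CARD('d))" by (simp add: Suc_leI)
    then show ?thesis by linarith
  qed
  then have "r x / (3 * sqrt (real CARD('d))) \<le> r x"
    using r_pos[of x] by (simp add: divide_le_eq mult_le_cancel_left1)
  then show ?thesis unfolding Omega_def by (rule normal_chart(3)[OF g radii])
qed

lemma Omega_subset: "Omega A g r x \<subseteq> ball_at x"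
  by (auto simp: Omega_eq)

lemma zcoord_Omega: "zcoord x ` Omega A g r x \<subseteq> open_cube 1"
proof safe
  fix u assume "u \<in> Omega A g r x"
  then have "norm (\<kappa> x u) < 1 / scal x" by (simp add: Omega_eq scal)
  then have "norm (zcoord x u) < 1"
    using scal_pos[of x] by (simp add: zcoord_def less_divide_eq mult.commute)
  then have "\<bar>zcoord x u $ i\<bar> < 1" for i
    using component_le_norm_cart[of "zcoord x u" i] by linarith
  then show "zcoord x u \<in> open_cube 1" unfolding open_cube_def by (auto simp: abs_less_iff)
qed

lemma ess_support_pull:
  assumes K: "compact K" "K \<subseteq> Omega A g r x" and G: "\<And>u. u \<notin> K \<Longrightarrow> G u = 0"
  shows "ess_support (pull x G) \<subseteq> open_cube 1"
proof -
  have "compact (zcoord x ` K)"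
    by (rule compact_continuous_image[OF continuous_on_subset[OF continuous_on_zcoord] K(1)])
      (use K(2) Omega_subset in auto)
  then have "open (- zcoord x ` K)" by (simp add: compact_imp_closed open_Compl)
  moreover have "pull x G z = 0" if "z \<notin> zcoord x ` K" for z
  proof (cases "z \<in> zcoord x ` ball_at x")
    case True
    then obtain u where u: "u \<in> ball_at x" "z = zcoord x u" by blast
    then have "u \<notin> K" using that by blast
    then show ?thesis using u G by (simp add: pull_def zinv_zcoord)
  qed (simp add: pull_def)
  ultimately have "ess_support (pull x G) \<subseteq> zcoord x ` K"
    unfolding ess_support_def by (auto intro!: exI[of _ "- zcoord x ` K"])
  also have "\<dots> \<subseteq> open_cube 1" using K(2) zcoord_Omega by blast
  finally show ?thesis .
qed

lemma L2_T2:
  assumes h: "continuous_on UNIV h"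
  shows "L2_fun \<nu> (T2 A g r \<iota> x h)"
  unfolding T2_eq_push_fun
proof (rule L2_push_fun)
  show "h \<in> borel_measurable borel" by (rule borel_measurable_continuous_onI[OF h])
  have "set_integrable lborel (cball 0 (scal x * r x)) (\<lambda>z. (cmod (h z))\<^sup>2)"
    unfolding set_integrable_def
    by (rule borel_integrable_compact)
      (auto intro!: continuous_intros continuous_on_subset[OF h])
  then have "set_integrable lborel (ball 0 (scal x * r x)) (\<lambda>z. (cmod (h z))\<^sup>2)"
    by (rule set_integrable_subset) auto
  then show "integrable lborel (\<lambda>z. indicator (zcoord x ` ball_at x) z *\<^sub>R (cmod (h z))\<^sup>2)"
    by (simp add: set_integrable_def zcoord_image)
qed

text \<open>The frame identity on \<open>Q\<close>, transported to the range of a projection localized on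
  \<open>\<Omega>\<^sub>x\<close>.\<close>

lemma local_frame_has_sum:
  assumes w: "local_parseval_frame m j0 \<epsilon> lam \<Gamma> w"
    and H: "H_localized A (Omega A g r x) P" and P: "L2_projection \<nu> P" and f: "L2_fun \<nu> f"
  shows "((\<lambda>i. (cmod (pairing \<nu> f (P (T2 A g r \<iota> x (w i)))))\<^sup>2) has_sum
    (L2_nrm \<nu> (P (\<lambda>u. cnj (f u))))\<^sup>2) (frame_index j0 \<Gamma>)"
proof -
  define G where "G u = cnj (P (\<lambda>v. cnj (f v)) u)" for u
  have Pf: "L2_fun \<nu> (P (\<lambda>v. cnj (f v)))"
    using P[unfolded L2_projection_def] L2_fun_cnj[OF f] by blast
  have G: "L2_fun \<nu> G" "L2_nrm \<nu> G = L2_nrm \<nu> (P (\<lambda>u. cnj (f u)))"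
    unfolding G_def[abs_def] using L2_fun_cnj[OF Pf] by (simp_all add: L2_nrm_cnj)
  obtain K where K: "compact K" "K \<subseteq> Omega A g r x" "\<forall>f. \<forall>u\<in>- K. P f u = 0"
    using H by (rule H_localized_compact_support)
  have G0: "G u = 0" if "u \<notin> K" for u using K(3) that by (simp add: G_def)
  then have "G u = 0" if "u \<notin> ball_at x" for u using that K(2) Omega_subset by blast
  note pull = L2_pull[OF G(1) this]
  have cont: "continuous_on UNIV (w i)" if "i \<in> frame_index j0 \<Gamma>" for i
    by (rule Cm_on_continuous[OF local_parseval_frameD(1)[OF w that]])
  have eq: "pairing \<nu> f (P (T2 A g r \<iota> x (w i))) = pairing lborel (pull x G) (w i)"
    if i: "i \<in> frame_index j0 \<Gamma>" for i
  proof -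
    have "pairing \<nu> f (P (T2 A g r \<iota> x (w i))) = pairing \<nu> G (T2 A g r \<iota> x (w i))"
      unfolding G_def[abs_def] by (rule pairing_L2_projection[OF P f L2_T2[OF cont[OF i]]])
    also have "\<dots> = pairing lborel (pull x G) (w i)"
      unfolding T2_eq_push_fun using G(1)
      by (intro pairing_push_fun borel_measurable_continuous_onI cont i) (simp add: L2_fun_def)
    finally show ?thesis .
  qed
  have "((\<lambda>i. (cmod (pairing lborel (pull x G) (w i)))\<^sup>2) has_sum
      (L2_nrm lborel (pull x G))\<^sup>2) (frame_index j0 \<Gamma>)"
    by (rule local_parseval_frameD(2)[OF w pull(1) ess_support_pull[OF K(1,2) G0]])
  moreover have "L2_nrm lborel (pull x G) = L2_nrm \<nu> (P (\<lambda>u. cnj (f u)))"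
    using pull(2) G(2) by (rule trans)
  ultimately have "((\<lambda>i. (cmod (pairing lborel (pull x G) (w i)))\<^sup>2) has_sum
      (L2_nrm \<nu> (P (\<lambda>u. cnj (f u))))\<^sup>2) (frame_index j0 \<Gamma>)" by (simp only:)
  then show ?thesis by (rule has_sum_cong[THEN iffD2, rotated]) (simp only: eq)
qed

end

lemma infsum_frame_index:
  fixes a :: "'x \<times> nat \<times> (int^'d) \<times> (int^'d) \<Rightarrow> real"
  assumes "a summable_on X \<times> frame_index j0 \<Gamma>"
  shows "infsum a (X \<times> frame_index j0 \<Gamma>) =
    (\<Sum>\<^sub>\<infinity>x\<in>X. \<Sum>\<^sub>\<infinity>j\<in>{j0..}. \<Sum>\<^sub>\<infinity>e\<in>E_set j0 j. \<Sum>\<^sub>\<infinity>k\<in>\<Gamma> j. a (x, j, e, k))"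
proof -
  have I: "frame_index j0 \<Gamma> = Sigma {j0..} (\<lambda>j. E_set j0 j \<times> \<Gamma> j)"
    by (auto simp: frame_index_def)
  have s1: "(\<lambda>i. a (x, i)) summable_on frame_index j0 \<Gamma>" if "x \<in> X" for x
    using summable_on_SigmaD1[of "\<lambda>x i. a (x, i)" X "\<lambda>_. frame_index j0 \<Gamma>" x] assms that by simp
  have s2: "(\<lambda>(e, k). a (x, j, e, k)) summable_on E_set j0 j \<times> \<Gamma> j" if "x \<in> X" "j \<ge> j0" for x j
    using summable_on_SigmaD1[of "\<lambda>j i. a (x, j, i)" "{j0..}" "\<lambda>j. E_set j0 j \<times> \<Gamma> j" j]
      s1[OF that(1)] that(2) unfolding I by (simp add: case_prod_unfold)
  have "infsum a (X \<times> frame_index j0 \<Gamma>) = (\<Sum>\<^sub>\<infinity>x\<in>X. \<Sum>\<^sub>\<infinity>i\<in>frame_index j0 \<Gamma>. a (x, i))"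
    by (rule infsum_Sigma_banach[OF assms, symmetric])
  also have "\<dots> = (\<Sum>\<^sub>\<infinity>x\<in>X. \<Sum>\<^sub>\<infinity>j\<in>{j0..}. \<Sum>\<^sub>\<infinity>i\<in>E_set j0 j \<times> \<Gamma> j. a (x, j, i))"
    unfolding I
    by (intro infsum_cong infsum_Sigma_banach[symmetric]) (use s1[unfolded I] in simp)
  also have "\<dots> = (\<Sum>\<^sub>\<infinity>x\<in>X. \<Sum>\<^sub>\<infinity>j\<in>{j0..}. \<Sum>\<^sub>\<infinity>e\<in>E_set j0 j. \<Sum>\<^sub>\<infinity>k\<in>\<Gamma> j. a (x, j, e, k))"
    by (intro infsum_cong infsum_Sigma_banach[symmetric])
      (use s2 in \<open>simp add: case_prod_unfold\<close>)
  finally show ?thesis .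
qed

theorem corollary5p5:
  fixes A :: "('a::{t2_space,second_countable_topology}, real^'d) chart set"
    and g :: "'a metric"
    and \<nu> :: "'a measure"
    and r :: "'a \<Rightarrow> real"
    and \<iota> :: "'a \<Rightarrow> 'a tvec \<Rightarrow> real^'d"
    and m :: enat and j0 lam :: nat and \<epsilon> :: real
    and \<Gamma> :: "nat \<Rightarrow> (int^'d) set"
    and w :: "nat \<times> (int^'d) \<times> (int^'d) \<Rightarrow> real^'d \<Rightarrow> complex"
    and X :: "'a set"
    and P :: "'a \<Rightarrow> ('a \<Rightarrow> complex) \<Rightarrow> 'a \<Rightarrow> complex"
  assumes "riemannian_manifold A g" and "connected (UNIV :: 'a set)"
    and "riemannian_measure A g \<nu>"
    and "normal_radii A g r \<iota>"
    and "local_parseval_frame m j0 \<epsilon> lam \<Gamma> w"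
    and "countable X"
    and "smooth_decomposition A \<nu> X (Omega A g r) P"
  shows "parseval_frame \<nu> (X \<times> frame_index j0 \<Gamma>) (\<lambda>(x, i). P x (T2 A g r \<iota> x (w i)))
    \<and> (\<forall>x\<in>X. \<forall>i\<in>frame_index j0 \<Gamma>.
         Cm_fun A m (P x (T2 A g r \<iota> x (w i))) \<and>
         fun_support (P x (T2 A g r \<iota> x (w i))) \<subseteq> Omega A g r x)
    \<and> (\<forall>f. L2_fun \<nu> f \<longrightarrow>
         (L2_nrm \<nu> f)\<^sup>2 =
           (\<Sum>\<^sub>\<infinity>x\<in>X. \<Sum>\<^sub>\<infinity>j\<in>{j0..}. \<Sum>\<^sub>\<infinity>e\<in>E_set j0 j. \<Sum>\<^sub>\<infinity>k\<in>\<Gamma> j.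
             (cmod (pairing \<nu> f (P x (T2 A g r \<iota> x (w (j, e, k))))))\<^sup>2))"
proof -
  interpret normal_coordinates A g \<nu> r \<iota> "\<lambda>x. 3 * sqrt (real CARD('d)) / r x"
    by unfold_locales (use assms in auto)
  note D = assms(7)[unfolded smooth_decomposition_def]
  note P = D[THEN conjunct2, THEN conjunct1, THEN bspec]
  let ?I = "frame_index j0 \<Gamma>"
  let ?h = "\<lambda>(x, i). P x (T2 A g r \<iota> x (w i))"
  note Cm = local_parseval_frameD(1)[OF assms(5)]
  have L2: "L2_fun \<nu> (P x (T2 A g r \<iota> x (w i)))" if "x \<in> X" "i \<in> ?I" for x i
    using P[OF that(1)] L2_T2[OF Cm_on_continuous[OF Cm[OF that(2)]]]
    unfolding L2_projection_def by blast
  have sum: "((\<lambda>i. (cmod (pairing \<nu> f (?h i)))\<^sup>2) has_sum (L2_nrm \<nu> f)\<^sup>2) (X \<times> ?I)"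
    if f: "L2_fun \<nu> f" for f
  proof -
    have 1: "((\<lambda>i. (cmod (pairing \<nu> f (?h (x, i))))\<^sup>2) has_sum
        (L2_nrm \<nu> (P x (\<lambda>u. cnj (f u))))\<^sup>2) ?I" if "x \<in> X" for x
      using local_frame_has_sum[OF assms(5) P[OF that, THEN conjunct1] P[OF that, THEN conjunct2] f]
      by simp
    have 2: "((\<lambda>x. (L2_nrm \<nu> (P x (\<lambda>u. cnj (f u))))\<^sup>2) has_sum (L2_nrm \<nu> f)\<^sup>2) X"
      using D[THEN conjunct2, THEN conjunct2, THEN conjunct2, THEN conjunct2, THEN spec, THEN mp,
          OF L2_fun_cnj[OF f]] by (simp add: L2_nrm_cnj)
    have "(\<lambda>i. (cmod (pairing \<nu> f (?h i)))\<^sup>2) summable_on X \<times> ?I"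
      by (rule summable_on_SigmaI[OF 1 has_sum_imp_summable[OF 2]]) simp_all
    then show ?thesis by (intro has_sum_SigmaI[OF 1 2])
  qed
  show ?thesis
  proof (intro conjI ballI allI impI)
    show "parseval_frame \<nu> (X \<times> ?I) ?h"
      unfolding parseval_frame_def using sum L2 by auto
  next
    fix x i assume x: "x \<in> X" and i: "i \<in> ?I"
    show "Cm_fun A m (P x (T2 A g r \<iota> x (w i)))"
      by (rule Cm_H_localized[OF smooth chart Cm_T2[OF Cm[OF i]] P[OF x, THEN conjunct1] Omega_subset])
    obtain K where K: "compact K" "K \<subseteq> Omega A g r x" "\<forall>f. \<forall>u\<in>- K. P x f u = 0"
      using P[OF x, THEN conjunct1] by (rule H_localized_compact_support)
    have "fun_support (P x (T2 A g r \<iota> x (w i))) \<subseteq> K"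
      unfolding fun_support_def
      by (rule closure_minimal) (use K(3) compact_imp_closed[OF K(1)] in blast)+
    then show "fun_support (P x (T2 A g r \<iota> x (w i))) \<subseteq> Omega A g r x" using K(2) by blast
  next
    fix f assume f: "L2_fun \<nu> f"
    show "(L2_nrm \<nu> f)\<^sup>2 =
           (\<Sum>\<^sub>\<infinity>x\<in>X. \<Sum>\<^sub>\<infinity>j\<in>{j0..}. \<Sum>\<^sub>\<infinity>e\<in>E_set j0 j. \<Sum>\<^sub>\<infinity>k\<in>\<Gamma> j.
             (cmod (pairing \<nu> f (P x (T2 A g r \<iota> x (w (j, e, k))))))\<^sup>2)"
      using infsumI[OF sum[OF f]] infsum_frame_index[OF has_sum_imp_summable[OF sum[OF f]]] by simp
  qed
qed

end
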